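(* Let $\Bbbk$ be a field, let $h,k\ge 1$ be integers, and let $\lambda=(\lambda_1\ge\cdots\ge\lambda_k\ge 0)$ be a partition with at most $k$ parts and with $\lambda_1\le h$. Then the dependence subscheme $\mathcal{D}(U_\lambda^{h,k})\subseteq(\mathbb{P}^1)^{[k]}$ is the vanishing locus of $$e_0(x_1,y_1,\ldots,x_k,y_k)^{h-\lambda_1}\,s_\lambda(x_1,y_1,\ldots,x_k,y_k),$$ via the isomorphism $(\mathbb{P}^1)^{[k]}\cong\operatorname{Sym}^k(\mathbb{P}^1)$. Here $s_\lambda$ is the bihomogeneous Schur polynomial in $k$ variables, $e_0=y_1\cdots y_k$, and $U_\lambda^{h,k}$ is the width-$h$, height-$k$ monomial set of $\lambda$.
   Context: Let $R=\Bbbk[x,y]$ with the standard grading, $R_d$ its degree-$d$ part, and $\mathrm{Mon}_d$ the set of monomials of degree $d$ in $x,y$. **Hilbert scheme.** $(\mathbb{P}^1)^{[k]}$ is the Hilbert scheme of length-$k$ subschemes of $\mathbb{P}^1$, equivalently the moduli space of principal homogeneous ideals of $R$ generated by a nonzero form of degree $k$. It is identified with $\mathbb{P}^k$, where $[a_0:\cdots:a_k]$ corresponds to the ideal $(a_0x^k+a_1x^{k-1}y+\cdots+a_ky^k)$. It is identified with $\operatorname{Sym}^k(\mathbb{P}^1)$ by sending the unordered $k$-tuple $[x_1:y_1],\ldots,[x_k:y_k]$ (with multiplicity) to the ideal generated by $\prod_{i=1}^k(y_ix-x_iy)$. Under these identifications, sections of $\mathcal{O}(n)$ on $\mathbb{P}^k$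 correspond to polynomials in the $k$ pairs of variables $x_1,y_1,\ldots,x_k,y_k$ that are invariant under the symmetric group $S_k$ permuting the pairs and are homogeneous of degree $n$ in each pair $(x_i,y_i)$. The vanishing locus of such a polynomial means the zero scheme of the corresponding section. **Dependence scheme.** For each $d$ there is a tautological exact sequence of vector bundles $0\to\mathcal{I}_d\to\mathcal{R}_d\to\mathcal{Q}_d\to 0$ on $(\mathbb{P}^1)^{[k]}$, where $\mathcal{R}_d$ is the trivial bundle with fiber $R_d$, and the fiber of $\mathcal{I}_d$ at an ideal $I$ is $I_d=I\cap R_d$. For $U\subseteq\mathrm{Mon}_d$ with $|U|=\ell$, the wedge of the monomials in $U$ is, up to sign, an element of $\bigwedge^\ell R_d$; its image under the map induced by $\mathcal{R}_d\to\mathcal{Q}_d$ is a global section $\sigma_U$ of $\bigwedge^\ell\mathcal{Q}_d$. The dependence scheme $\mathcal{D}(U)\subseteq(\mathbb{P}^1)^{[k]}$ is the zero scheme of $\sigma_U$; its points are the ideals $I$ such that the monomials in $U$ are linearly dependent modulo $I_d$. **Bihomogeneous symmetric polynomials.** For integers $l_1>l_2>\cdots>l_k\ge 0$ put $a_{(l_1,\ldots,l_k)}(x_1,y_1,\ldots,x_k,y_k)=\det\big(x_j^{l_i}y_j^{l_1-l_i}\big)_{i,j=1}^k$. For a partition $\lambda$ with at most $k$ parts (padded with zeros to length $k$), $$s_\lambda(x_1,y_1,\ldots,x_k,y_k)=\frac{a_{(\lambda_1+k-1,\lambda_2+k-2,\ldots,\lambda_k+0)}(x_1,y_1,\ldots,x_k,y_k)}{a_{(k-1,k-2,\ldots,0)}(x_1,y_1,\ldots,x_k,y_k)},$$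 which is homogeneous of degree $\lambda_1$ in each pair $(x_i,y_i)$. Also $e_j=\sum_{A\subseteq\{1,\ldots,k\},\,|A|=j}\prod_{i\in A}x_i\prod_{i\notin A}y_i$, so $e_0=y_1\cdots y_k$. **Monomial set of a partition.** Draw the Young diagram of $\lambda$ in English notation (longest row on top), with top-left corner at $(0,0)$, inside the rectangle with corners $(0,0),(h,0),(0,-k),(h,-k)$ (so row $i$ occupies the boxes $[0,\lambda_i]\times[-i,-i+1]$). The width-$h$, height-$k$ rim path $P_\lambda^{h,k}$ is the lattice path that starts at $(h,0)$ and follows the edge of the Young diagram by unit steps down and to the left until it reaches $(0,-k)$. Its steps are indexed by $i=0,1,\ldots,h+k-1$. Then $$U_\lambda^{h,k}=\{x^{h+k-1-i}y^i\in\mathrm{Mon}_{h+k-1}: \text{the }i\text{th step of }P_\lambda^{h,k}\text{ is vertical}\},$$ a set of $k$ monomials. *)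

theory Defs
  imports "HOL-Library.Poly_Mapping" "Jordan_Normal_Form.Determinant"
begin

section \<open>Polynomials\<close>

text \<open>Polynomials with coefficients in \<open>'r\<close> and variables indexed by the natural numbers.
  The ring in which a polynomial is meant to live is recorded by the carrier \<open>polys\<close>.\<close>

type_synonym 'r mpoly = "(nat \<Rightarrow>\<^sub>0 nat) \<Rightarrow>\<^sub>0 'r"

definition const :: "'r \<Rightarrow> 'r::zero mpoly" where
  "const c = Poly_Mapping.single 0 c"

definition monomial :: "(nat \<Rightarrow>\<^sub>0 nat) \<Rightarrow> 'r::zero_neq_one mpoly" where
  "monomial m = Poly_Mapping.single m 1"

definition indet :: "nat \<Rightarrow> 'r::zero_neq_one mpoly" where
  "indet v = monomial (Poly_Mapping.single v 1)"

text \<open>\<open>polys A V\<close> is \<open>A[V]\<close>, for a subring \<open>A\<close> of \<open>'r\<close>; \<open>forms A V d\<close> is its part of degree \<open>d\<close>.\<close>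

definition polys :: "'r::zero set \<Rightarrow> nat set \<Rightarrow> 'r mpoly set" where
  "polys A V = {p. \<forall>m \<in> Poly_Mapping.keys p.
      Poly_Mapping.keys m \<subseteq> V \<and> Poly_Mapping.lookup p m \<in> A}"

definition forms :: "'r::zero set \<Rightarrow> nat set \<Rightarrow> nat \<Rightarrow> 'r mpoly set" where
  "forms A V d = {p \<in> polys A V. \<forall>m \<in> Poly_Mapping.keys p.
      (\<Sum>v \<in> Poly_Mapping.keys m. Poly_Mapping.lookup m v) = d}"

definition subst :: "(nat \<Rightarrow> 'r mpoly) \<Rightarrow> 'r::comm_ring_1 mpoly \<Rightarrow> 'r mpoly" where
  "subst \<sigma> p = (\<Sum>m \<in> Poly_Mapping.keys p. const (Poly_Mapping.lookup p m) *
      (\<Prod>v \<in> Poly_Mapping.keys m. \<sigma> v ^ Poly_Mapping.lookup m v))"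

text \<open>In \<open>R = k[x,y]\<close>, and in \<open>A[x,y]\<close> for a ring \<open>A\<close>, \<open>x\<close> is variable 0 and \<open>y\<close> is variable 1.
  Monomials of \<open>R\<close> are represented by their exponents.\<close>

definition mon :: "nat \<Rightarrow> nat \<Rightarrow> (nat \<Rightarrow>\<^sub>0 nat)" where
  "mon p q = Poly_Mapping.single 0 p + Poly_Mapping.single 1 q"

section \<open>Projective space and its closed subschemes\<close>

text \<open>The homogeneous coordinates \<open>a\<^sub>0, \<dots>, a\<^sub>k\<close> of projective \<open>k\<close>-space are the variables \<open>0, \<dots>, k\<close>.
  The standard chart where \<open>a\<^sub>i\<close> does not vanish is the spectrum of the polynomial ring in the
  quotients \<open>a\<^sub>j / a\<^sub>i\<close>, \<open>j \<noteq> i\<close>; here \<open>a\<^sub>j / a\<^sub>i\<close> is the variable \<open>j\<close>. A closed subscheme is given by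
  its ideals on the charts \<open>i = 0, \<dots>, k\<close>; for other \<open>i\<close> the value is the empty set by convention.\<close>

type_synonym 'a subscheme = "nat \<Rightarrow> 'a mpoly set"

definition chart_ring :: "nat \<Rightarrow> nat \<Rightarrow> 'a::zero mpoly set" where
  "chart_ring k i = polys UNIV ({..k} - {i})"

definition chart_coord :: "nat \<Rightarrow> nat \<Rightarrow> 'a::zero_neq_one mpoly" where
  "chart_coord i j = (if j = i then monomial 0 else indet j)"

text \<open>The zero scheme of a section \<open>G\<close> of \<open>O(n)\<close>, that is, of a form of degree \<open>n\<close> in
  \<open>a\<^sub>0, \<dots>, a\<^sub>k\<close>.\<close>

definition zero_scheme :: "nat \<Rightarrow> 'a::comm_ring_1 mpoly \<Rightarrow> 'a subscheme" where
  "zero_scheme k G i =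
    (if i \<le> k then {p * subst (chart_coord i) G | p. p \<in> chart_ring k i} else {})"

section \<open>Dependence schemes\<close>

text \<open>A point \<open>[a\<^sub>0 : \<dots> : a\<^sub>k]\<close> is the ideal generated by \<open>\<Sum>j\<le>k. a\<^sub>j x\<^bsup>k-j\<^esup> y\<^sup>j\<close>. On chart \<open>i\<close>, with
  coordinate ring \<open>A\<close>, the universal such ideal is generated by the following form in \<open>A[x,y]\<close>,
  and the bundle of degree-\<open>d\<close> parts \<open>I\<^sub>d\<close> is the \<open>A\<close>-module \<open>univ_ideal_part k i d\<close>.\<close>

definition univ_form :: "nat \<Rightarrow> nat \<Rightarrow> 'a::comm_ring_1 mpoly mpoly" where
  "univ_form k i = (\<Sum>j\<le>k. const (chart_coord i j) * monomial (mon (k - j) j))"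

definition univ_ideal_part :: "nat \<Rightarrow> nat \<Rightarrow> nat \<Rightarrow> 'a::comm_ring_1 mpoly mpoly set" where
  "univ_ideal_part k i d =
    {univ_form k i * g | g. g \<in> polys (chart_ring k i) {0, 1}} \<inter> forms (chart_ring k i) {0, 1} d"

text \<open>Alternating \<open>A\<close>-multilinear forms in \<open>l\<close> arguments on an \<open>A\<close>-submodule \<open>M\<close> of \<open>A[x,y]\<close>.\<close>

definition alternating_form ::
  "'r::comm_ring_1 set \<Rightarrow> 'r mpoly set \<Rightarrow> nat \<Rightarrow> ('r mpoly list \<Rightarrow> 'r) \<Rightarrow> bool" where
  "alternating_form A M l \<phi> \<longleftrightarrow>
    (\<forall>ps. length ps = l \<and> set ps \<subseteq> M \<longrightarrow>
      \<phi> ps \<in> A \<and>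
      (\<forall>j<l. \<forall>p\<in>M. \<forall>q\<in>M. \<phi> (ps[j := p + q]) = \<phi> (ps[j := p]) + \<phi> (ps[j := q])) \<and>
      (\<forall>j<l. \<forall>c\<in>A. \<phi> (ps[j := const c * ps ! j]) = c * \<phi> ps) \<and>
      (\<not> distinct ps \<longrightarrow> \<phi> ps = 0))"

text \<open>The dual of the \<open>l\<close>-th exterior power of \<open>Q\<^sub>d = R\<^sub>d / I\<^sub>d\<close> on chart \<open>i\<close>: by the universal
  properties of quotients and exterior powers, these are the alternating forms on \<open>R\<^sub>d\<close> (with
  coefficients in \<open>A\<close>) that vanish as soon as one argument lies in \<open>I\<^sub>d\<close>.\<close>

definition ext_quotient_dual ::
  "nat \<Rightarrow> nat \<Rightarrow> nat \<Rightarrow> nat \<Rightarrow> ('a::comm_ring_1 mpoly mpoly list \<Rightarrow> 'a mpoly) set" where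
  "ext_quotient_dual k i d l =
    {\<phi>. alternating_form (chart_ring k i) (forms (chart_ring k i) {0, 1} d) l \<phi> \<and>
       (\<forall>ps. length ps = l \<and> set ps \<subseteq> forms (chart_ring k i) {0, 1} d \<and>
          set ps \<inter> univ_ideal_part k i d \<noteq> {} \<longrightarrow> \<phi> ps = 0)}"

text \<open>The zero scheme of a section \<open>\<sigma>\<close> of a vector bundle \<open>E\<close> is cut out by the image of
  \<open>\<sigma>\<^sup>\<or> : E\<^sup>\<or> \<rightarrow> O\<close>, here for \<open>E\<close> the \<open>|U|\<close>-th exterior power of \<open>Q\<^sub>d\<close> and \<open>\<sigma>\<close> the wedge of the monomials
  in \<open>U\<close>. All orderings \<open>us\<close> of \<open>U\<close> are admitted; they change \<open>\<sigma>\<close> by a sign only, which does not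
  affect the image.\<close>

definition dependence_scheme ::
  "nat \<Rightarrow> nat \<Rightarrow> (nat \<Rightarrow>\<^sub>0 nat) set \<Rightarrow> 'a::comm_ring_1 subscheme" where
  "dependence_scheme k d U i =
    (if i \<le> k then
       {\<phi> (map monomial us) | \<phi> us.
          \<phi> \<in> ext_quotient_dual k i d (card U) \<and> distinct us \<and> set us = U}
     else {})"

section \<open>Bihomogeneous symmetric polynomials\<close>

text \<open>The \<open>k\<close> pairs of variables are numbered from 0: \<open>(xv 0, yv 0), \<dots>, (xv (k-1), yv (k-1))\<close>.
  Likewise the parts of a partition are \<open>lam ! 0, \<dots>, lam ! (k-1)\<close>.\<close>

definition xv :: "nat \<Rightarrow> 'a::zero_neq_one mpoly" where
  "xv i = indet (2 * i)"

definition yv :: "nat \<Rightarrow> 'a::zero_neq_one mpoly" where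
  "yv i = indet (2 * i + 1)"

definition elem_sym :: "nat \<Rightarrow> nat \<Rightarrow> 'a::comm_ring_1 mpoly" where
  "elem_sym k j = (\<Sum>A \<in> {A. A \<subseteq> {..<k} \<and> card A = j}. (\<Prod>i\<in>A. xv i) * (\<Prod>i\<in>{..<k} - A. yv i))"

definition alternant :: "nat list \<Rightarrow> 'a::comm_ring_1 mpoly" where
  "alternant l = det (mat (length l) (length l)
     (\<lambda>(i, j). xv j ^ (l ! i) * yv j ^ (l ! 0 - l ! i)))"

text \<open>The quotient of two alternants, taken in an integral domain.\<close>

definition schur :: "nat list \<Rightarrow> 'a::idom mpoly" where
  "schur lam = (let k = length lam in
     THE s. s * alternant (map (\<lambda>i. k - 1 - i) [0..<k])
            = alternant (map (\<lambda>i. lam ! i + (k - 1 - i)) [0..<k]))"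

text \<open>The product of the linear forms \<open>y\<^sub>i x - x\<^sub>i y\<close>, in \<open>k[x\<^sub>0, y\<^sub>0, \<dots>][x, y]\<close>. The identification of
  \<open>Sym\<^sup>k\<close> of the projective line with projective \<open>k\<close>-space is \<open>a\<^sub>j \<mapsto> sym_coord k j\<close>, the coefficient
  of \<open>x\<^bsup>k-j\<^esup> y\<^sup>j\<close> in this product.\<close>

definition point_form :: "nat \<Rightarrow> 'a::comm_ring_1 mpoly mpoly" where
  "point_form k = (\<Prod>i<k. const (yv i) * indet 0 - const (xv i) * indet 1)"

definition sym_coord :: "nat \<Rightarrow> nat \<Rightarrow> 'a::comm_ring_1 mpoly" where
  "sym_coord k j = Poly_Mapping.lookup (point_form k) (mon (k - j) j)"

text \<open>The section \<open>G\<close> of \<open>O(n)\<close> corresponds to the polynomial \<open>F\<close> in the \<open>x\<^sub>i, y\<^sub>i\<close>. Such an \<open>F\<close> is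
  automatically symmetric and of degree \<open>n\<close> in each pair. There is at most one such \<open>G\<close>, because
  \<open>sym_coord k j\<close> is, up to sign, \<open>elem_sym k j\<close>, and these are algebraically independent.\<close>

definition corresponds :: "nat \<Rightarrow> nat \<Rightarrow> 'a::comm_ring_1 mpoly \<Rightarrow> 'a mpoly \<Rightarrow> bool" where
  "corresponds k n G F \<longleftrightarrow> G \<in> forms UNIV {..k} n \<and> subst (sym_coord k) G = F"

definition is_vanishing_locus ::
  "nat \<Rightarrow> nat \<Rightarrow> 'a::comm_ring_1 mpoly \<Rightarrow> 'a subscheme \<Rightarrow> bool" where
  "is_vanishing_locus k n F Z \<longleftrightarrow> (\<exists>G. corresponds k n G F \<and> Z = zero_scheme k G)"

section \<open>Rim paths\<close>

datatype rim_step = Leftward | Downward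

text \<open>\<open>rim_path c rs\<close> is the path from column \<open>c\<close> at the top of the rows with the given lengths
  along the edge of the diagram to column 0 at the bottom of the rows.\<close>

fun rim_path :: "nat \<Rightarrow> nat list \<Rightarrow> rim_step list" where
  "rim_path c [] = replicate c Leftward"
| "rim_path c (r # rs) = replicate (c - r) Leftward @ Downward # rim_path r rs"

definition monomial_set :: "nat \<Rightarrow> nat list \<Rightarrow> (nat \<Rightarrow>\<^sub>0 nat) set" where
  "monomial_set h lam = (let k = length lam in
     {mon (h + k - 1 - i) i | i. i < h + k \<and> rim_path h lam ! i = Downward})"

end

theory Submission
  imports Defs
begin

text \<open>A degree-\<open>d\<close> form, \<open>d = h + k - 1\<close>, is a vector of length \<open>h + k\<close>. Consider the square
  matrix whose first \<open>h\<close> rows are the shifts of \<open>(a\<^sub>0, \<dots>, a\<^sub>k)\<close>, a basis of \<open>I\<^sub>d\<close>, and whose last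
  \<open>k\<close> rows are given forms; its determinant is an alternating form on \<open>R\<^sub>d / I\<^sub>d\<close>. On a chart it
  generates the dual of the top exterior power of \<open>Q\<^sub>d\<close>: any two such alternating forms are
  proportional by Cramer's rule, and the maximal minors of the shift rows generate the unit ideal. So
  the dependence scheme is cut out by the form \<open>G\<close> in \<open>a\<^sub>0, \<dots>, a\<^sub>k\<close> obtained when the last rows
  are the monomials of \<open>U\<close>. After the substitution \<open>a\<^sub>j \<mapsto> sym_coord k j\<close>, multiplying the matrix
  by the evaluations at the \<open>k\<close> points shows that \<open>G\<close> times the Vandermonde determinant is the
  determinant of the monomials of \<open>U\<close> evaluated at the points, which is \<open>e\<^sub>0\<^bsup>h - \<lambda>\<^sub>1\<^esup>\<close> times the
  alternant of \<open>\<lambda>\<close>.\<close>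

section \<open>Alternating forms over a subring\<close>

lemma permutes_lessI: "\<pi> permutes {0..<n} \<Longrightarrow> i < n \<Longrightarrow> \<pi> i < (n :: nat)"
  using permutes_in_image[of \<pi> "{0..<n}" i] by simp

text \<open>The chart rings are subsets of one polynomial type rather than types of their own, so
  closure under the ring operations is recorded for a set.\<close>

locale ring_subset =
  fixes A :: "'r::comm_ring_1 set"
  assumes zero_closed [simp, intro]: "0 \<in> A"
    and one_closed [simp, intro]: "1 \<in> A"
    and add_closed [simp, intro]: "x \<in> A \<Longrightarrow> y \<in> A \<Longrightarrow> x + y \<in> A"
    and mult_closed [simp, intro]: "x \<in> A \<Longrightarrow> y \<in> A \<Longrightarrow> x * y \<in> A"
    and uminus_closed [simp, intro]: "x \<in> A \<Longrightarrow> - x \<in> A"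
begin

lemma sum_closed: "(\<And>i. i \<in> S \<Longrightarrow> f i \<in> A) \<Longrightarrow> sum f S \<in> A"
  by (induction S rule: infinite_finite_induct) auto

lemma prod_closed: "(\<And>i. i \<in> S \<Longrightarrow> f i \<in> A) \<Longrightarrow> prod f S \<in> A"
  by (induction S rule: infinite_finite_induct) auto

lemma power_closed [simp, intro]: "x \<in> A \<Longrightarrow> x ^ n \<in> A"
  by (induction n) auto

lemma signof_closed [simp, intro]: "signof p \<in> A"
  by (cases p rule: sign_cases) auto

lemma det_closed:
  assumes "B \<in> carrier_mat n n" "\<And>i j. i < n \<Longrightarrow> j < n \<Longrightarrow> B $$ (i, j) \<in> A"
  shows "det B \<in> A"
  unfolding det_def'[OF assms(1)]
  by (intro sum_closed mult_closed signof_closed prod_closed)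
    (auto intro!: assms(2) simp: permutes_lessI)

lemma cofactor_closed:
  assumes "B \<in> carrier_mat n n" "\<And>i j. i < n \<Longrightarrow> j < n \<Longrightarrow> B $$ (i, j) \<in> A"
    and "i < n" "j < n"
  shows "cofactor B i j \<in> A"
proof -
  have "det (mat_delete B i j) \<in> A"
  proof (rule det_closed)
    show "mat_delete B i j \<in> carrier_mat (n - 1) (n - 1)"
      using assms(1) by (rule mat_delete_carrier)
    show "mat_delete B i j $$ (a, b) \<in> A" if "a < n - 1" "b < n - 1" for a b
      using that assms by (auto simp: mat_delete_def)
  qed
  then show ?thesis
    by (simp add: cofactor_def)
qed

end

section \<open>Multilinear expansion of an alternating form\<close>

locale alternating = ring_subset A for A :: "'r::comm_ring_1 set" +
  fixes M :: "'r mpoly set" and k :: nat and \<phi> :: "'r mpoly list \<Rightarrow> 'r"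
  assumes alt: "alternating_form A M k \<phi>"
    and M_zero [simp, intro]: "0 \<in> M"
    and M_add [simp, intro]: "p \<in> M \<Longrightarrow> q \<in> M \<Longrightarrow> p + q \<in> M"
    and M_scale [simp, intro]: "c \<in> A \<Longrightarrow> p \<in> M \<Longrightarrow> const c * p \<in> M"
begin

text \<open>With families in place of lists, changing an argument is a function update and
  reordering the arguments is composition. Only the values below \<open>k\<close> matter.\<close>

definition \<psi> :: "(nat \<Rightarrow> 'r mpoly) \<Rightarrow> 'r" where
  "\<psi> Q = \<phi> (map Q [0..<k])"

lemma \<psi>_cong: "(\<And>j. j < k \<Longrightarrow> P j = Q j) \<Longrightarrow> \<psi> P = \<psi> Q"
  unfolding \<psi>_def by (intro arg_cong[where f = \<phi>] map_cong) auto

lemma \<phi>_eq_\<psi>: "length ps = k \<Longrightarrow> \<phi> ps = \<psi> (\<lambda>j. ps ! j)"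
  unfolding \<psi>_def by (intro arg_cong[where f = \<phi>] nth_equalityI) auto

lemma map_upt_update: "(map Q [0..<k])[j := p] = map (Q(j := p)) [0..<k]"
  by (rule nth_equalityI) (auto simp: nth_list_update)

lemma M_sum: "(\<And>i. i \<in> S \<Longrightarrow> f i \<in> M) \<Longrightarrow> sum f S \<in> M"
  by (induction S rule: infinite_finite_induct) auto

lemma \<psi>_closed: "(\<And>i. i < k \<Longrightarrow> Q i \<in> M) \<Longrightarrow> \<psi> Q \<in> A"
  using alt unfolding alternating_form_def \<psi>_def by (auto simp: image_subset_iff)

lemma \<psi>_add:
  assumes "\<And>i. i < k \<Longrightarrow> Q i \<in> M" "j < k" "p \<in> M" "q \<in> M"
  shows "\<psi> (Q(j := p + q)) = \<psi> (Q(j := p)) + \<psi> (Q(j := q))"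
proof -
  have "length (map Q [0..<k]) = k" "set (map Q [0..<k]) \<subseteq> M"
    using assms(1) by auto
  then have "\<phi> ((map Q [0..<k])[j := p + q]) = \<phi> ((map Q [0..<k])[j := p]) + \<phi> ((map Q [0..<k])[j := q])"
    using alt assms unfolding alternating_form_def by blast
  then show ?thesis
    by (simp add: map_upt_update \<psi>_def)
qed

lemma \<psi>_scale:
  assumes "\<And>i. i < k \<Longrightarrow> Q i \<in> M" "j < k" "p \<in> M" "c \<in> A"
  shows "\<psi> (Q(j := const c * p)) = c * \<psi> (Q(j := p))"
proof -
  let ?L = "map (Q(j := p)) [0..<k]"
  have "length ?L = k" "set ?L \<subseteq> M"
    using assms(1,3) by auto
  then have "\<phi> (?L[j := const c * ?L ! j]) = c * \<phi> ?L"
    using alt assms unfolding alternating_form_def by blast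
  moreover have "?L ! j = p"
    using assms(2) by simp
  ultimately show ?thesis
    by (simp add: map_upt_update \<psi>_def)
qed

lemma \<psi>_repeated:
  assumes "\<And>i. i < k \<Longrightarrow> Q i \<in> M" "i < k" "j < k" "i \<noteq> j" "Q i = Q j"
  shows "\<psi> Q = 0"
proof -
  have "length (map Q [0..<k]) = k" "set (map Q [0..<k]) \<subseteq> M"
    using assms(1) by auto
  moreover have "\<not> distinct (map Q [0..<k])"
    using assms(2-5) unfolding distinct_map inj_on_def set_upt
    by (metis atLeastLessThan_iff zero_le)
  ultimately show ?thesis
    using alt unfolding alternating_form_def \<psi>_def by blast
qed

lemma \<psi>_sum:
  assumes Q: "\<And>i. i < k \<Longrightarrow> Q i \<in> M" and j: "j < k" and "finite S"
    and q: "\<And>m. m \<in> S \<Longrightarrow> q m \<in> M" and c: "\<And>m. m \<in> S \<Longrightarrow> c m \<in> A"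
  shows "\<psi> (Q(j := (\<Sum>m\<in>S. const (c m) * q m))) = (\<Sum>m\<in>S. c m * \<psi> (Q(j := q m)))"
  using \<open>finite S\<close> q c
proof (induction S)
  case empty
  have "\<psi> (Q(j := const 0 * 0)) = 0 * \<psi> (Q(j := 0))"
    by (rule \<psi>_scale) (use Q j in auto)
  then show ?case
    by (simp add: const_def fun_upd_def)
next
  case (insert x S)
  have "\<psi> (Q(j := const (c x) * q x + (\<Sum>m\<in>S. const (c m) * q m)))
      = \<psi> (Q(j := const (c x) * q x)) + \<psi> (Q(j := (\<Sum>m\<in>S. const (c m) * q m)))"
    by (rule \<psi>_add) (use Q j insert.prems in \<open>auto intro!: M_sum\<close>)
  moreover have "\<psi> (Q(j := const (c x) * q x)) = c x * \<psi> (Q(j := q x))"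
    by (rule \<psi>_scale) (use Q j insert.prems in auto)
  ultimately show ?case
    using insert by (simp add: fun_upd_def)
qed

text \<open>Polarisation: the form vanishes with \<open>Q a + Q b\<close> in both slots, and
  expanding leaves only the two mixed terms. Since alternation means vanishing on repetitions, the
  characteristic does not matter.\<close>

lemma \<psi>_swap:
  assumes Q: "\<And>i. i < k \<Longrightarrow> Q i \<in> M" and ab: "a < k" "b < k" "a \<noteq> b"
  shows "\<psi> (Q \<circ> Transposition.transpose a b) = - \<psi> Q"
proof -
  define R where "R p q = Q(a := p, b := q)" for p q
  have M: "Q a \<in> M" "Q b \<in> M"
    using Q ab by auto
  have left: "\<psi> (R (p + q) r) = \<psi> (R p r) + \<psi> (R q r)" if "p \<in> M" "q \<in> M" "r \<in> M" for p q r
    using \<psi>_add[of "Q(b := r)" a p q] Q ab that by (simp add: R_def fun_upd_twist)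
  have right: "\<psi> (R r (p + q)) = \<psi> (R r p) + \<psi> (R r q)" if "p \<in> M" "q \<in> M" "r \<in> M" for p q r
    using \<psi>_add[of "Q(a := r)" b p q] Q ab that by (simp add: R_def)
  have rep: "\<psi> (R p p) = 0" if "p \<in> M" for p
    by (rule \<psi>_repeated[of _ a b]) (use Q ab that in \<open>auto simp: R_def\<close>)
  have "0 = \<psi> (R (Q a + Q b) (Q a + Q b))"
    using rep M by simp
  also have "\<dots> = \<psi> (R (Q a) (Q a)) + \<psi> (R (Q a) (Q b)) + (\<psi> (R (Q b) (Q a)) + \<psi> (R (Q b) (Q b)))"
    using M by (simp add: left right)
  also have "\<dots> = \<psi> (R (Q a) (Q b)) + \<psi> (R (Q b) (Q a))"
    using M by (simp add: rep)
  also have "R (Q a) (Q b) = Q"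
    by (simp add: R_def)
  also have "R (Q b) (Q a) = Q \<circ> Transposition.transpose a b"
    by (auto simp: R_def fun_eq_iff transpose_def)
  finally show ?thesis
    by (simp add: eq_neg_iff_add_eq_0 add.commute comp_def)
qed

lemma \<psi>_permute:
  assumes "\<pi> permutes {0..<k}" "\<And>i. i < k \<Longrightarrow> Q i \<in> M"
  shows "\<psi> (Q \<circ> \<pi>) = signof \<pi> * \<psi> Q"
proof -
  have "finite {0..<k}" by simp
  from assms(1) this assms(2) show ?thesis
  proof (induction \<pi> arbitrary: Q rule: permutes_induct)
    case id
    then show ?case by simp
  next
    case (swap a b \<pi>)
    let ?t = "Transposition.transpose a b"
    have tM: "(Q \<circ> ?t) i \<in> M" if "i < k" for i
      using that swap by (auto simp: transpose_def)
    have "\<psi> (Q \<circ> (?t \<circ> \<pi>)) = \<psi> ((Q \<circ> ?t) \<circ> \<pi>)"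
      by (simp add: comp_assoc)
    also have "\<dots> = signof \<pi> * \<psi> (Q \<circ> ?t)"
      by (rule swap.IH) (use tM in auto)
    also have "\<psi> (Q \<circ> ?t) = - \<psi> Q"
      by (rule \<psi>_swap) (use swap in auto)
    also have "signof \<pi> * - \<psi> Q = - signof \<pi> * \<psi> Q"
      by simp
    also have "- signof \<pi> = (signof (?t \<circ> \<pi>) :: 'r)"
    proof -
      have "permutation \<pi>"
        using swap by (auto simp: permutation_permutes)
      moreover have "permutation ?t"
        by (rule permutation_swap_id)
      ultimately
      show ?thesis
        using swap.hyps by (simp add: sign_compose sign_swap_id)
    qed
    finally show ?case .
  qed
qed

text \<open>Multilinearity is applied to the slots below \<open>t\<close> only. A function
  \<open>f\<close> records the index chosen in each of these slots and is the identity elsewhere, so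
  that \<open>t = 0\<close> leaves a single choice.\<close>

lemma \<psi>_expand:
  assumes Q: "\<And>i. i < k \<Longrightarrow> Q i \<in> M" and C: "\<And>i j. i < k \<Longrightarrow> j < k \<Longrightarrow> C i j \<in> A"
    and "t \<le> k"
  defines "P \<equiv> \<lambda>j. \<Sum>m\<in>{0..<k}. const (C j m) * Q m"
  shows "\<psi> P = (\<Sum>f\<in>{f. (\<forall>i<t. f i < k) \<and> (\<forall>i\<ge>t. f i = i)}.
      (\<Prod>j\<in>{0..<t}. C j (f j)) * \<psi> (\<lambda>j. if j < t then Q (f j) else P j))"
  using \<open>t \<le> k\<close>
proof (induction t)
  case 0
  have "{f :: nat \<Rightarrow> nat. (\<forall>i<0. f i < k) \<and> (\<forall>i\<ge>0. f i = i)} = {id}"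
    by auto
  then show ?case by simp
next
  case (Suc t)
  let ?F = "\<lambda>t. {f :: nat \<Rightarrow> nat. (\<forall>i<t. f i < k) \<and> (\<forall>i\<ge>t. f i = i)}"
  let ?H = "\<lambda>t f j. if j < t then Q (f j) else P j"
  have P: "P j \<in> M" if "j < k" for j
    unfolding P_def using that Q C by (auto intro!: M_sum)
  have step: "\<psi> (?H t f) = (\<Sum>m\<in>{0..<k}. C t m * \<psi> (?H (Suc t) (f(t := m))))" if f: "f \<in> ?F t" for f
  proof -
    have "\<psi> (?H t f) = \<psi> ((?H t f)(t := (\<Sum>m\<in>{0..<k}. const (C t m) * Q m)))"
      by (intro arg_cong[where f = \<psi>]) (auto simp: P_def)
    also have "\<dots> = (\<Sum>m\<in>{0..<k}. C t m * \<psi> ((?H t f)(t := Q m)))"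
      by (rule \<psi>_sum) (use Q P C f Suc.prems in auto)
    also have "\<dots> = (\<Sum>m\<in>{0..<k}. C t m * \<psi> (?H (Suc t) (f(t := m))))"
      by (intro sum.cong refl arg_cong2[where f = "(*)"] arg_cong[where f = \<psi>]) auto
    finally show ?thesis .
  qed
  have "\<psi> P = (\<Sum>f\<in>?F t. (\<Prod>j\<in>{0..<t}. C j (f j)) * (\<Sum>m\<in>{0..<k}. C t m * \<psi> (?H (Suc t) (f(t := m)))))"
    using Suc step by simp
  also have "\<dots> = (\<Sum>f\<in>?F t. \<Sum>m\<in>{0..<k}.
      (\<Prod>j\<in>{0..<t}. C j (f j)) * (C t m * \<psi> (?H (Suc t) (f(t := m)))))"
    by (simp add: sum_distrib_left)
  also have "\<dots> = (\<Sum>(f, m)\<in>?F t \<times> {0..<k}.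
      (\<Prod>j\<in>{0..<t}. C j (f j)) * (C t m * \<psi> (?H (Suc t) (f(t := m)))))"
    by (rule sum.cartesian_product)
  also have "\<dots> = (\<Sum>f\<in>?F (Suc t). (\<Prod>j\<in>{0..<Suc t}. C j (f j)) * \<psi> (?H (Suc t) f))"
  \<comment> \<open>A choice for the slots up to \<open>t\<close> is a choice for the slots below
    \<open>t\<close> together with its value at \<open>t\<close>.\<close>
  proof (rule sum.reindex_bij_witness[where j = "\<lambda>(f, m). f(t := m)" and i = "\<lambda>f. (f(t := t), f t)"])
    fix x assume "x \<in> ?F t \<times> {0..<k}"
    then obtain f m where x: "x = (f, m)" "f \<in> ?F t" "m < k" by auto
    then show "((case x of (f, m) \<Rightarrow> f(t := m))(t := t), (case x of (f, m) \<Rightarrow> f(t := m)) t) = x"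
      by auto
    show "(case x of (f, m) \<Rightarrow> f(t := m)) \<in> ?F (Suc t)"
      using x by auto
    have "(\<Prod>j\<in>{0..<t}. C j ((f(t := m)) j)) = (\<Prod>j\<in>{0..<t}. C j (f j))"
      by (rule prod.cong) auto
    then show "(\<Prod>j\<in>{0..<Suc t}. C j ((case x of (f, m) \<Rightarrow> f(t := m)) j)) *
        \<psi> (?H (Suc t) (case x of (f, m) \<Rightarrow> f(t := m))) =
        (case x of (f, m) \<Rightarrow> (\<Prod>j\<in>{0..<t}. C j (f j)) * (C t m * \<psi> (?H (Suc t) (f(t := m)))))"
      unfolding x(1) prod.case by (simp add: mult.assoc)
  qed (use Suc.prems in \<open>auto simp: less_Suc_eq\<close>)
  finally show ?case .
qed

text \<open>In the full expansion a choice that is not injective repeats an argument and contributes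
  zero. The permutations that remain contribute their signs, which gives the Leibniz
  formula.\<close>

lemma \<psi>_det:
  assumes Q: "\<And>i. i < k \<Longrightarrow> Q i \<in> M" and C: "\<And>i j. i < k \<Longrightarrow> j < k \<Longrightarrow> C i j \<in> A"
  shows "\<psi> (\<lambda>j. \<Sum>m\<in>{0..<k}. const (C j m) * Q m) = det (mat k k (\<lambda>(i, j). C i j)) * \<psi> Q"
proof -
  let ?F = "{f :: nat \<Rightarrow> nat. (\<forall>i<k. f i < k) \<and> (\<forall>i\<ge>k. f i = i)}"
  have "finite {f. (\<forall>i\<in>{0..<k}. f i \<in> {0..<k}) \<and> (\<forall>i. i \<notin> {0..<k} \<longrightarrow> f i = i)}"
    by (rule finite_bounded_functions) auto
  also have "{f. (\<forall>i\<in>{0..<k}. f i \<in> {0..<k}) \<and> (\<forall>i. i \<notin> {0..<k} \<longrightarrow> f i = i)} = ?F"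
    by auto
  finally have fin: "finite ?F" .
  let ?H = "\<lambda>f j. if j < k then Q (f j) else (\<Sum>m\<in>{0..<k}. const (C j m) * Q m)"
  have "\<psi> (\<lambda>j. \<Sum>m\<in>{0..<k}. const (C j m) * Q m) = (\<Sum>f\<in>?F. (\<Prod>j\<in>{0..<k}. C j (f j)) * \<psi> (?H f))"
    using \<psi>_expand[of Q C k, OF Q C] by simp
  also have "\<dots> = (\<Sum>f | f permutes {0..<k}. (\<Prod>j\<in>{0..<k}. C j (f j)) * \<psi> (?H f))"
  proof (rule sum.mono_neutral_right[OF fin])
    show "{f. f permutes {0..<k}} \<subseteq> ?F"
      by (auto simp: permutes_lessI permutes_not_in)
    show "\<forall>f\<in>?F - {f. f permutes {0..<k}}. (\<Prod>j\<in>{0..<k}. C j (f j)) * \<psi> (?H f) = 0"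
    proof
      fix f assume f: "f \<in> ?F - {f. f permutes {0..<k}}"
      have "\<not> inj_on f {0..<k}"
      proof
        assume "inj_on f {0..<k}"
        have im: "f ` {0..<k} \<subseteq> {0..<k}"
          using f by auto
        then have "bij_betw f {0..<k} {0..<k}"
          using endo_inj_surj[of "{0..<k}" f] im \<open>inj_on f {0..<k}\<close> by (auto simp: bij_betw_def)
        then have "f permutes {0..<k}"
          using f by (intro bij_imp_permutes) auto
        then show False using f by auto
      qed
      then obtain i j where "i < k" "j < k" "i \<noteq> j" "f i = f j"
        by (auto simp: inj_on_def)
      then have "\<psi> (?H f) = 0"
        by (intro \<psi>_repeated[of _ i j]) (use Q f in auto)
      then show "(\<Prod>j\<in>{0..<k}. C j (f j)) * \<psi> (?H f) = 0" by simp
    qed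
  qed
  also have "\<dots> = (\<Sum>f | f permutes {0..<k}. (signof f * (\<Prod>j\<in>{0..<k}. C j (f j))) * \<psi> Q)"
  proof (rule sum.cong)
    fix f assume "f \<in> {f. f permutes {0..<k}}"
    then have f: "f permutes {0..<k}" by simp
    have "\<psi> (?H f) = \<psi> (Q \<circ> f)"
      by (rule \<psi>_cong) auto
    then show "(\<Prod>j\<in>{0..<k}. C j (f j)) * \<psi> (?H f) = (signof f * (\<Prod>j\<in>{0..<k}. C j (f j))) * \<psi> Q"
      using \<psi>_permute[OF f Q] by (simp add: algebra_simps)
  qed simp
  also have "\<dots> = det (mat k k (\<lambda>(i, j). C i j)) * \<psi> Q"
    unfolding sum_distrib_right[symmetric]
    by (subst det_def'[of _ k]; (rule mat_carrier)?)
      (auto intro!: sum.cong arg_cong2[where f = "(*)"] prod.cong simp: permutes_lessI)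
  finally show ?thesis .
qed

text \<open>The \<open>w j\<close> will be elements of the ideal part. They are added one slot at a
  time, and by additivity each costs only a value of \<open>\<psi>\<close> with some
  \<open>w j\<close> as an argument, which is zero by \<open>van\<close>.\<close>

lemma \<psi>_det_mod:
  assumes Q: "\<And>i. i < k \<Longrightarrow> Q i \<in> M" and C: "\<And>i j. i < k \<Longrightarrow> j < k \<Longrightarrow> C i j \<in> A"
    and w: "\<And>i. i < k \<Longrightarrow> w i \<in> M"
    and van: "\<And>R i j. (\<And>i. i < k \<Longrightarrow> R i \<in> M) \<Longrightarrow> j < k \<Longrightarrow> i < k \<Longrightarrow> R j = w i \<Longrightarrow> \<psi> R = 0"
  shows "\<psi> (\<lambda>j. (\<Sum>m\<in>{0..<k}. const (C j m) * Q m) + w j)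
    = det (mat k k (\<lambda>(i, j). C i j)) * \<psi> Q"
proof -
  define P where "P j = (\<Sum>m\<in>{0..<k}. const (C j m) * Q m)" for j
  have P: "P j \<in> M" if "j < k" for j
    unfolding P_def using that Q C by (auto intro!: M_sum)
  \<comment> \<open>The slots below \<open>t\<close> already carry their error term.\<close>
  have "\<psi> (\<lambda>j. if j < t then P j + w j else P j) = \<psi> P" if "t \<le> k" for t
    using that
  proof (induction t)
    case (Suc t)
    let ?R = "\<lambda>j. if j < t then P j + w j else P j"
    have "\<psi> (\<lambda>j. if j < Suc t then P j + w j else P j) = \<psi> (?R(t := P t + w t))"
      by (rule \<psi>_cong) auto
    also have "\<dots> = \<psi> (?R(t := P t)) + \<psi> (?R(t := w t))"
      by (rule \<psi>_add) (use Suc.prems P w in auto)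
    also have "\<psi> (?R(t := w t)) = 0"
      by (rule van[of _ t t]) (use Suc.prems P w in auto)
    also have "?R(t := P t) = ?R"
      by auto
    finally show ?case
      using Suc by simp
  qed simp
  from this[of k] have "\<psi> (\<lambda>j. P j + w j) = \<psi> P"
    by (auto cong: \<psi>_cong)
  then show ?thesis
    using \<psi>_det[of Q C, OF Q C] by (simp add: P_def[abs_def])
qed

end

section \<open>Polynomials and binary forms\<close>

lemma const_hom [simp]:
  "const (0 :: 'r::comm_ring_1) = 0" "const (1 :: 'r) = 1"
  "const (c + d :: 'r) = const c + const d" "const (c * d :: 'r) = const c * const d"
  "const (- c :: 'r) = - const c" "const (c - d :: 'r) = const c - const d"
  by (simp_all add: const_def single_add mult_single single_uminus single_diff)

lemma const_power: "const ((c :: 'r::comm_ring_1) ^ n) = const c ^ n"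
  by (induction n) auto

lemma const_sum: "const (\<Sum>i\<in>S. f i :: 'r::comm_ring_1) = (\<Sum>i\<in>S. const (f i))"
  by (induction S rule: infinite_finite_induct) auto

lemma const_prod: "const (\<Prod>i\<in>S. f i :: 'r::comm_ring_1) = (\<Prod>i\<in>S. const (f i))"
  by (induction S rule: infinite_finite_induct) auto

lemma const_eq_iff [simp]: "const c = const d \<longleftrightarrow> c = d"
  unfolding const_def by (rule inj_eq[OF inj_single])

lemma lookup_const_mult [simp]:
  "Poly_Mapping.lookup (const c * p) m = c * Poly_Mapping.lookup (p :: 'r::comm_ring_1 mpoly) m"
  unfolding const_def lookup_mult lookup_single by (simp add: when_mult)

lemma monomial_mult: "monomial m * monomial m' = (monomial (m + m') :: 'r::comm_ring_1 mpoly)"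
  by (simp add: monomial_def mult_single)

lemma lookup_monomial: "Poly_Mapping.lookup (monomial m) n = (if m = n then 1 else 0)"
  by (simp add: monomial_def lookup_single when_def)

lemma lookup_monomial_mult:
  "Poly_Mapping.lookup (monomial m * p :: 'r::comm_ring_1 mpoly) (m + n) = Poly_Mapping.lookup p n"
  unfolding monomial_def lookup_mult lookup_single by (simp add: when_mult)

lemma lookup_monomial_mult_eq_0:
  assumes "\<And>n'. n \<noteq> m + n'"
  shows "Poly_Mapping.lookup (monomial m * p :: 'r::comm_ring_1 mpoly) n = 0"
  unfolding monomial_def lookup_mult lookup_single using assms by (simp add: when_mult)

lemma poly_expand:
  assumes "finite S" "Poly_Mapping.keys p \<subseteq> S"
  shows "p = (\<Sum>m\<in>S. const (Poly_Mapping.lookup p m) * (monomial m :: 'r::comm_ring_1 mpoly))"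
proof (rule poly_mapping_eqI)
  fix n
  have "Poly_Mapping.lookup (\<Sum>m\<in>S. const (Poly_Mapping.lookup p m) * (monomial m :: 'r mpoly)) n
      = (\<Sum>m\<in>S. if m = n then Poly_Mapping.lookup p m else 0)"
    unfolding lookup_sum by (intro sum.cong) (auto simp: lookup_monomial)
  also have "\<dots> = Poly_Mapping.lookup p n"
    using assms by (auto simp: in_keys_iff)
  finally show "Poly_Mapping.lookup p n
      = Poly_Mapping.lookup (\<Sum>m\<in>S. const (Poly_Mapping.lookup p m) * (monomial m :: 'r mpoly)) n" ..
qed

section \<open>Evaluation of monomials and substitution as a ring homomorphism\<close>

definition eval_mon :: "(nat \<Rightarrow> 'r::comm_ring_1) \<Rightarrow> (nat \<Rightarrow>\<^sub>0 nat) \<Rightarrow> 'r" where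
  "eval_mon \<sigma> m = (\<Prod>v\<in>Poly_Mapping.keys m. \<sigma> v ^ Poly_Mapping.lookup m v)"

lemma eval_mon_superset:
  assumes "finite S" "Poly_Mapping.keys m \<subseteq> S"
  shows "eval_mon \<sigma> m = (\<Prod>v\<in>S. \<sigma> v ^ Poly_Mapping.lookup m v)"
  unfolding eval_mon_def using assms by (intro prod.mono_neutral_left) (auto simp: in_keys_iff)

lemma eval_mon_add: "eval_mon \<sigma> (m + m') = eval_mon \<sigma> m * eval_mon \<sigma> m'"
proof -
  let ?S = "Poly_Mapping.keys m \<union> Poly_Mapping.keys m'"
  have "Poly_Mapping.keys (m + m') \<subseteq> ?S"
    by (rule keys_add)
  then show ?thesis
    by (simp add: eval_mon_superset[of ?S] lookup_add power_add prod.distrib)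
qed

lemma eval_mon_zero [simp]: "eval_mon \<sigma> 0 = 1"
  by (simp add: eval_mon_def)

lemma eval_mon_single [simp]: "eval_mon \<sigma> (Poly_Mapping.single v n) = \<sigma> v ^ n"
  by (subst eval_mon_superset[of "{v}"]) auto

lemma eval_mon_mon [simp]: "eval_mon \<sigma> (mon p q) = \<sigma> 0 ^ p * \<sigma> 1 ^ q"
  by (simp add: mon_def eval_mon_add)

lemma subst_superset:
  assumes "finite S" "Poly_Mapping.keys p \<subseteq> S"
  shows "subst \<sigma> p = (\<Sum>m\<in>S. const (Poly_Mapping.lookup p m) * eval_mon \<sigma> m)"
  unfolding subst_def eval_mon_def[symmetric]
  using assms by (intro sum.mono_neutral_left) (auto simp: in_keys_iff)

lemma subst_add: "subst \<sigma> (p + q) = subst \<sigma> p + subst \<sigma> q"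
proof -
  let ?S = "Poly_Mapping.keys p \<union> Poly_Mapping.keys q"
  have "Poly_Mapping.keys (p + q) \<subseteq> ?S"
    by (rule keys_add)
  then show ?thesis
    by (simp add: subst_superset[of ?S] lookup_add algebra_simps sum.distrib)
qed

lemma subst_zero [simp]: "subst \<sigma> 0 = 0"
  by (simp add: subst_def)

lemma subst_sum: "subst \<sigma> (\<Sum>i\<in>S. f i) = (\<Sum>i\<in>S. subst \<sigma> (f i))"
  by (induction S rule: infinite_finite_induct) (auto simp: subst_add)

lemma subst_term: "subst \<sigma> (const c * monomial m) = const c * eval_mon \<sigma> m"
proof -
  have "const c * monomial m = Poly_Mapping.single m c"
    by (simp add: const_def monomial_def mult_single)
  then show ?thesis
    by (subst subst_superset[of "{m}"]) auto
qed

lemma subst_mult: "subst \<sigma> (p * q) = subst \<sigma> p * subst \<sigma> q"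
proof -
  let ?P = "Poly_Mapping.keys p" and ?Q = "Poly_Mapping.keys q"
  let ?a = "Poly_Mapping.lookup p" and ?b = "Poly_Mapping.lookup q"
  have "p * q = (\<Sum>m\<in>?P. const (?a m) * monomial m) * (\<Sum>n\<in>?Q. const (?b n) * monomial n)"
    using poly_expand[of ?P p] poly_expand[of ?Q q] by simp
  also have "\<dots> = (\<Sum>m\<in>?P. \<Sum>n\<in>?Q. const (?a m * ?b n) * monomial (m + n))"
    unfolding sum_product by (simp add: monomial_mult[symmetric] mult_ac)
  finally have "subst \<sigma> (p * q) = (\<Sum>m\<in>?P. \<Sum>n\<in>?Q. const (?a m * ?b n) * eval_mon \<sigma> (m + n))"
    by (simp only: subst_sum subst_term)
  also have "\<dots> = subst \<sigma> p * subst \<sigma> q"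
    by (simp add: subst_superset[of ?P p] subst_superset[of ?Q q] sum_product eval_mon_add mult_ac)
  finally show ?thesis .
qed

lemma subst_monomial [simp]: "subst \<sigma> (monomial m) = eval_mon \<sigma> m"
  using subst_term[of \<sigma> 1 m] by simp

lemma subst_const [simp]: "subst \<sigma> (const c) = const c"
  using subst_term[of \<sigma> c 0] by (simp add: monomial_def)

lemma subst_indet [simp]: "subst \<sigma> (indet v) = \<sigma> v"
  by (simp add: indet_def)

lemma subst_one [simp]: "subst \<sigma> 1 = 1"
  using subst_const[of \<sigma> 1] by simp

interpretation subst: comm_ring_hom "subst \<sigma>"
  by unfold_locales (simp_all add: subst_add subst_mult)

section \<open>Degrees, and monomials in x and y\<close>

definition total_degree :: "(nat \<Rightarrow>\<^sub>0 nat) \<Rightarrow> nat" where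
  "total_degree m = (\<Sum>v\<in>Poly_Mapping.keys m. Poly_Mapping.lookup m v)"

lemma total_degree_add: "total_degree (m + n) = total_degree m + total_degree n"
proof -
  have eq: "total_degree l = (\<Sum>v\<in>Poly_Mapping.keys m \<union> Poly_Mapping.keys n. Poly_Mapping.lookup l v)"
    if "Poly_Mapping.keys l \<subseteq> Poly_Mapping.keys m \<union> Poly_Mapping.keys n" for l
    unfolding total_degree_def using that by (intro sum.mono_neutral_left) (auto simp: in_keys_iff)
  show ?thesis
    using eq[of "m + n"] eq[of m] eq[of n] keys_add[of m n]
    by (simp add: lookup_add sum.distrib)
qed

lemma total_degree_mon [simp]: "total_degree (mon p q) = p + q"
  by (simp add: mon_def total_degree_add) (simp add: total_degree_def)

lemma lookup_mon [simp]:
  "Poly_Mapping.lookup (mon p q) 0 = p" "Poly_Mapping.lookup (mon p q) (Suc 0) = q"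
  by (simp_all add: mon_def lookup_add lookup_single when_def)

lemma mon_eq_iff [simp]: "mon p q = mon p' q' \<longleftrightarrow> p = p' \<and> q = q'"
  by (metis lookup_mon)

lemma mon_add: "mon p q + mon p' q' = mon (p + p') (q + q')"
  by (simp add: mon_def single_add algebra_simps)

lemma keys_mon: "Poly_Mapping.keys (mon p q) \<subseteq> {0, 1}"
  unfolding mon_def by (rule order.trans[OF keys_add]) auto

lemma mon_eqI:
  assumes "Poly_Mapping.keys m \<subseteq> {0, 1}" "total_degree m = d"
  shows "\<exists>c\<le>d. m = mon (d - c) c"
proof -
  have "total_degree m = (\<Sum>v\<in>{0, 1}. Poly_Mapping.lookup m v)"
    using assms unfolding total_degree_def
    by (intro sum.mono_neutral_left) (auto simp: in_keys_iff)
  then have d: "d = Poly_Mapping.lookup m 0 + Poly_Mapping.lookup m 1"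
    using assms(2) by simp
  have "m = mon (d - Poly_Mapping.lookup m 1) (Poly_Mapping.lookup m 1)"
  proof (rule poly_mapping_eqI)
    fix v :: nat
    consider "v = 0" | "v = 1" | "v \<notin> {0, 1}" by auto
    then show "Poly_Mapping.lookup m v
        = Poly_Mapping.lookup (mon (d - Poly_Mapping.lookup m 1) (Poly_Mapping.lookup m 1)) v"
    proof cases
      case 3
      then have "v \<notin> Poly_Mapping.keys m" "\<And>p q. v \<notin> Poly_Mapping.keys (mon p q)"
        using assms(1) keys_mon by blast+
      then show ?thesis by (simp add: in_keys_iff)
    qed (use d in auto)
  qed
  then show ?thesis
    using d by (intro exI[of _ "Poly_Mapping.lookup m 1"]) simp
qed

section \<open>Polynomials and forms with coefficients in a subring\<close>

context ring_subset
begin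

lemma polys_altdef:
  "p \<in> polys A V \<longleftrightarrow> (\<forall>m. Poly_Mapping.lookup p m \<in> A)
     \<and> (\<forall>m\<in>Poly_Mapping.keys p. Poly_Mapping.keys m \<subseteq> V)"
  unfolding polys_def mem_Collect_eq by (metis in_keys_iff zero_closed)

lemma lookup_mult_closed:
  fixes p q :: "'r mpoly"
  assumes "\<And>m. Poly_Mapping.lookup p m \<in> A" "\<And>m. Poly_Mapping.lookup q m \<in> A"
  shows "Poly_Mapping.lookup (p * q) m \<in> A"
proof -
  let ?P = "Poly_Mapping.keys p"
  have "p * q = (\<Sum>n\<in>?P. const (Poly_Mapping.lookup p n) * (monomial n * q))"
    using arg_cong[OF poly_expand[of ?P p], of "\<lambda>p. p * q"]
    by (simp add: sum_distrib_right mult.assoc)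
  then have "Poly_Mapping.lookup (p * q) m
      = (\<Sum>n\<in>?P. Poly_Mapping.lookup p n * Poly_Mapping.lookup (monomial n * q) m)"
    by (simp add: lookup_sum)
  moreover have "Poly_Mapping.lookup (monomial n * q) m \<in> A" for n
    by (cases "\<exists>n'. m = n + n'") (auto simp: lookup_monomial_mult lookup_monomial_mult_eq_0 assms)
  ultimately show ?thesis
    using assms by (auto intro!: sum_closed)
qed

text \<open>Serves at two levels: for polynomials over \<open>A\<close>, and with
  \<open>A = UNIV\<close> for the chart rings themselves.\<close>

lemma ring_subset_polys: "ring_subset (polys A V)"
proof
  show "x * y \<in> polys A V" if "x \<in> polys A V" "y \<in> polys A V" for x y
    unfolding polys_altdef
  proof (intro conjI ballI allI)
    show "Poly_Mapping.lookup (x * y) m \<in> A" for m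
      using that by (intro lookup_mult_closed) (auto simp: polys_altdef)
    fix m assume "m \<in> Poly_Mapping.keys (x * y)"
    then obtain a b where "m = a + b" "a \<in> Poly_Mapping.keys x" "b \<in> Poly_Mapping.keys y"
      using keys_mult[of x y] by blast
    then show "Poly_Mapping.keys m \<subseteq> V"
      using that keys_add[of a b] unfolding polys_def by blast
  qed
  show "x + y \<in> polys A V" if "x \<in> polys A V" "y \<in> polys A V" for x y
    using that keys_add[of x y] unfolding polys_altdef by (simp add: lookup_add) blast
qed (auto simp: polys_altdef lookup_one when_def)

lemma forms_altdef: "p \<in> forms A V d \<longleftrightarrow> p \<in> polys A V \<and> (\<forall>m\<in>Poly_Mapping.keys p. total_degree m = d)"
  unfolding forms_def total_degree_def by simp

lemma forms_zero [simp]: "0 \<in> forms A V d"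
  by (simp add: forms_altdef polys_altdef)

lemma forms_add:
  assumes "p \<in> forms A V d" "q \<in> forms A V d"
  shows "p + q \<in> forms A V d"
proof -
  interpret P: ring_subset "polys A V" by (rule ring_subset_polys)
  show ?thesis
    using assms keys_add[of p q] by (auto simp: forms_altdef)
qed

lemma forms_sum: "(\<And>i. i \<in> S \<Longrightarrow> f i \<in> forms A V d) \<Longrightarrow> sum f S \<in> forms A V d"
  by (induction S rule: infinite_finite_induct) (auto intro: forms_add)

lemma forms_mult:
  assumes "p \<in> forms A V a" "q \<in> forms A V b"
  shows "p * q \<in> forms A V (a + b)"
proof -
  interpret P: ring_subset "polys A V" by (rule ring_subset_polys)
  show ?thesis
    unfolding forms_altdef
  proof (intro conjI ballI)
    show "p * q \<in> polys A V"
      using assms by (auto simp: forms_altdef)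
    fix m assume "m \<in> Poly_Mapping.keys (p * q)"
    then obtain x y where "m = x + y" "x \<in> Poly_Mapping.keys p" "y \<in> Poly_Mapping.keys q"
      using keys_mult[of p q] by blast
    then show "total_degree m = a + b"
      using assms by (auto simp: forms_altdef total_degree_add)
  qed
qed

lemma forms_monomial:
  "Poly_Mapping.keys m \<subseteq> V \<Longrightarrow> total_degree m = d \<Longrightarrow> monomial m \<in> forms A V d"
  by (auto simp: forms_altdef polys_altdef monomial_def lookup_single when_def total_degree_def)

lemma forms_const: "c \<in> A \<Longrightarrow> const c \<in> forms A V 0"
  by (auto simp: forms_altdef polys_altdef const_def lookup_single when_def total_degree_def in_keys_iff)

lemma forms_scale: "c \<in> A \<Longrightarrow> p \<in> forms A V d \<Longrightarrow> const c * p \<in> forms A V d"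
  using forms_mult[OF forms_const] by fastforce

lemma forms_prod:
  "(\<And>i. i \<in> S \<Longrightarrow> f i \<in> forms A V (d i)) \<Longrightarrow> prod f S \<in> forms A V (sum d S)"
proof (induction S rule: infinite_finite_induct)
  case (insert x S)
  then show ?case by (auto intro: forms_mult)
qed (use forms_const[of 1] in auto)

lemma monomial_mon_in_forms: "p + q = d \<Longrightarrow> monomial (mon p q) \<in> forms A {0, 1} d"
  using keys_mon by (intro forms_monomial) auto

lemma forms_coeff: "p \<in> forms A V d \<Longrightarrow> Poly_Mapping.lookup p m \<in> A"
  by (simp add: forms_altdef polys_altdef)

lemma keys_binary_form:
  assumes "p \<in> forms A {0, 1} d"
  shows "Poly_Mapping.keys p \<subseteq> (\<lambda>c. mon (d - c) c) ` {..d}"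
  using assms mon_eqI unfolding forms_altdef polys_def by fast

lemma inj_on_mon: "inj_on (\<lambda>c. mon (d - c) c) S"
  by (auto simp: inj_on_def)

lemma binary_form_expand:
  assumes "p \<in> forms A {0, 1} d"
  shows "p = (\<Sum>c\<le>d. const (Poly_Mapping.lookup p (mon (d - c) c)) * monomial (mon (d - c) c))"
  using poly_expand[OF _ keys_binary_form[OF assms]]
  by (simp add: sum.reindex[OF inj_on_mon] o_def)

lemma subst_binary_form:
  assumes "p \<in> forms A {0, 1} d"
  shows "subst \<sigma> p = (\<Sum>c\<le>d. const (Poly_Mapping.lookup p (mon (d - c) c)) * (\<sigma> 0 ^ (d - c) * \<sigma> 1 ^ c))"
  by (subst binary_form_expand[OF assms]) (simp only: subst_sum subst_term eval_mon_mon)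

lemma binary_form_eqI:
  assumes "p \<in> forms A {0, 1} d" "q \<in> forms A {0, 1} d"
    and "\<And>c. c \<le> d \<Longrightarrow> Poly_Mapping.lookup p (mon (d - c) c) = Poly_Mapping.lookup q (mon (d - c) c)"
  shows "p = q"
  by (subst binary_form_expand[OF assms(1)], subst binary_form_expand[OF assms(2)])
    (simp add: assms(3))

end

lemma ring_subset_UNIV: "ring_subset UNIV"
  by unfold_locales auto

section \<open>Determinants of band matrices\<close>

text \<open>A matrix of Sylvester type. Column \<open>c\<close> stands for
  \<open>x^(h+k-1-c) y^c\<close>, and row \<open>r < h\<close> lists the coefficients of
  \<open>x^(h-1-r) y^r\<close> times the form with coefficients \<open>a\<close>.\<close>

definition band_mat :: "nat \<Rightarrow> nat \<Rightarrow> (nat \<Rightarrow> 'r::zero) \<Rightarrow> (nat \<Rightarrow> nat \<Rightarrow> 'r) \<Rightarrow> 'r mat" where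
  "band_mat h k a v = mat (h + k) (h + k) (\<lambda>(r, c).
     if r < h then (if r \<le> c \<and> c \<le> r + k then a (c - r) else 0) else v (r - h) c)"

lemma band_mat_carrier [simp, intro]: "band_mat h k a v \<in> carrier_mat (h + k) (h + k)"
  by (simp add: band_mat_def)

lemma dim_band_mat [simp]: "dim_row (band_mat h k a v) = h + k" "dim_col (band_mat h k a v) = h + k"
  by (simp_all add: band_mat_def)

lemma band_mat_index [simp]:
  "r < h + k \<Longrightarrow> c < h + k \<Longrightarrow> band_mat h k a v $$ (r, c) =
     (if r < h then (if r \<le> c \<and> c \<le> r + k then a (c - r) else 0) else v (r - h) c)"
  by (simp add: band_mat_def)

lemma det_mat_permute_sum:
  "det (mat n n (\<lambda>(i, j). g i j))
    = (\<Sum>\<pi> | \<pi> permutes {0..<n}. signof \<pi> * (\<Prod>i\<in>{0..<n}. g i (\<pi> i :: nat) :: 'r::comm_ring_1))"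
  by (subst det_def'[of _ n])
    (auto intro!: sum.cong arg_cong2[where f = "(*)"] prod.cong simp: permutes_lessI)

lemma det_scale_cols:
  "det (mat n n (\<lambda>(i, j). f j * g i j))
    = (\<Prod>j\<in>{0..<n}. f j :: 'r::comm_ring_1) * det (mat n n (\<lambda>(i, j). g i j))"
  unfolding det_mat_permute_sum sum_distrib_left
proof (rule sum.cong)
  fix \<pi> assume "\<pi> \<in> {\<pi>. \<pi> permutes {0..<n}}"
  then have "(\<Prod>j\<in>{0..<n}. f (\<pi> j)) = (\<Prod>j\<in>{0..<n}. f j)"
    using prod.permute[of \<pi> "{0..<n}" f] by (simp add: o_def)
  then show "signof \<pi> * (\<Prod>i\<in>{0..<n}. f (\<pi> i) * g i (\<pi> i))
      = (\<Prod>j\<in>{0..<n}. f j) * (signof \<pi> * (\<Prod>i\<in>{0..<n}. g i (\<pi> i)))"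
    by (simp add: prod.distrib algebra_simps)
qed simp

lemma det_upper_triangular_mat:
  assumes "\<And>i j. j < i \<Longrightarrow> i < n \<Longrightarrow> g i j = 0"
  shows "det (mat n n (\<lambda>(i, j). g i j :: 'r::comm_ring_1)) = (\<Prod>i\<in>{0..<n}. g i i)"
proof -
  have "det (mat n n (\<lambda>(i, j). g i j)) = prod_list (diag_mat (mat n n (\<lambda>(i, j). g i j)))"
    by (rule det_upper_triangular[of _ n]) (auto simp: upper_triangular_def assms)
  also have "\<dots> = (\<Prod>i\<in>{0..<n}. g i i)"
    by (simp add: diag_mat_def prod.distinct_set_conv_list[symmetric] cong: map_cong)
  finally show ?thesis .
qed

text \<open>Multiply the band matrix on the right by the matrix whose last \<open>k\<close> columns evaluate a form
  of degree \<open>h + k - 1\<close> at the \<open>k\<close> roots of \<open>\<Sum>t\<le>k. a\<^sub>t x\<^bsup>k-t\<^esup> y\<^sup>t\<close>, and whose first \<open>h\<close> columns are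
  unit vectors.\<close>

lemma det_band_mat_roots:
  fixes a X Y :: "nat \<Rightarrow> 'r::idom"
  assumes root: "\<And>j. j < k \<Longrightarrow> (\<Sum>t\<le>k. a t * (X j ^ (k - t) * Y j ^ t)) = 0"
    and e: "\<And>m. m < k \<Longrightarrow> e m < h + k"
  shows "det (band_mat h k a (\<lambda>m c. if c = e m then 1 else 0))
      * ((\<Prod>j\<in>{0..<k}. Y j) ^ h * det (mat k k (\<lambda>(i, j). X j ^ (k - 1 - i) * Y j ^ i)))
    = a 0 ^ h * det (mat k k (\<lambda>(i, j). X j ^ (h + k - 1 - e i) * Y j ^ e i))"
    (is "det ?D * _ = _ * det ?E")
proof -
  let ?n = "h + k"
  define W where "W = mat ?n ?n (\<lambda>(r, c). if c < h then (if r = c then 1 else 0)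
    else X (c - h) ^ (?n - 1 - r) * Y (c - h) ^ r)"
  have W: "W \<in> carrier_mat ?n ?n" by (simp add: W_def)
  let ?N = "mat h k (\<lambda>(r, j). X j ^ (?n - 1 - r) * Y j ^ r)"
  let ?W' = "mat k k (\<lambda>(i, j). Y j ^ h * (X j ^ (k - 1 - i) * Y j ^ i))"
  have pow: "Y j ^ h * (x * Y j ^ (i - h)) = x * Y j ^ i" if "i \<ge> h" for i j x
    using that by (simp add: mult.left_commute power_add[symmetric])
  have "W = four_block_mat (1\<^sub>m h) ?N (0\<^sub>m k h) ?W'"
    \<comment> \<open>Row \<open>h + i\<close> of the evaluation columns has exponents
      \<open>k - 1 - i\<close> and \<open>h + i\<close>, so \<open>Y j ^ h\<close> splits off from
      column \<open>j\<close> of the lower right block.\<close>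
    by (rule eq_matI) (auto simp: W_def pow add.commute)
  then have "det W = det (1\<^sub>m h) * det ?W'"
    using det_four_block_mat_lower_left_zero[of "1\<^sub>m h" h ?N k "0\<^sub>m k h" ?W'] by simp
  also have "det ?W' = (\<Prod>j\<in>{0..<k}. Y j ^ h) * det (mat k k (\<lambda>(i, j). X j ^ (k - 1 - i) * Y j ^ i))"
    by (rule det_scale_cols)
  finally have detW: "det W = (\<Prod>j\<in>{0..<k}. Y j) ^ h * det (mat k k (\<lambda>(i, j). X j ^ (k - 1 - i) * Y j ^ i))"
    by (simp add: prod_power_distrib)
  let ?T = "mat h h (\<lambda>(r, c). if r \<le> c \<and> c \<le> r + k then a (c - r) else 0)"
  let ?C = "mat k h (\<lambda>(m, c). if c = e m then 1 else 0)"
  \<comment> \<open>Evaluation kills the shift rows and turns the last \<open>k\<close> rows into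
    monomials at the roots; the unit columns merely copy the first \<open>h\<close> columns of the
    band matrix.\<close>
  have "?D * W = four_block_mat ?T (0\<^sub>m h k) ?C ?E"
  proof (rule eq_matI)
    fix r c assume "r < dim_row (four_block_mat ?T (0\<^sub>m h k) ?C ?E)"
      and "c < dim_col (four_block_mat ?T (0\<^sub>m h k) ?C ?E)"
    then have r: "r < ?n" and c: "c < ?n" by auto
    have prod: "(?D * W) $$ (r, c) = (\<Sum>s\<in>{0..<?n}. ?D $$ (r, s) * W $$ (s, c))"
      using r c W by (simp add: scalar_prod_def)
    consider "c < h" | "c \<ge> h" "r < h" | "c \<ge> h" "r \<ge> h" by linarith
    then show "(?D * W) $$ (r, c) = four_block_mat ?T (0\<^sub>m h k) ?C ?E $$ (r, c)"
    proof cases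
      case 1
      have "(?D * W) $$ (r, c) = (\<Sum>s\<in>{0..<?n}. if s = c then ?D $$ (r, s) else 0)"
        unfolding prod using 1 c by (intro sum.cong) (auto simp: W_def)
      also have "\<dots> = ?D $$ (r, c)"
        using c by simp
      finally show ?thesis
        using 1 r c by auto
    next
      case 2
      let ?g = "\<lambda>s. a (s - r) * (X (c - h) ^ (?n - 1 - s) * Y (c - h) ^ s)"
      have "(?D * W) $$ (r, c) = (\<Sum>s\<in>{0..<?n}. if r \<le> s \<and> s \<le> r + k then ?g s else 0)"
        unfolding prod using 2 r c by (intro sum.cong) (auto simp: W_def)
      also have "\<dots> = (\<Sum>s\<in>{r..r + k}. ?g s)"
        using 2 by (subst sum.inter_filter[symmetric]) (auto intro!: sum.cong)
      also have "\<dots> = (\<Sum>t\<le>k. ?g (t + r))"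
        using sum.shift_bounds_cl_nat_ivl[of ?g 0 r k] by (simp add: add.commute atMost_atLeast0)
      \<comment> \<open>The shift in row \<open>r\<close> is \<open>x^(h-1-r) y^r\<close> times the
        original form, and this factor comes out of the sum.\<close>
      also have "\<dots> = (\<Sum>t\<le>k. X (c - h) ^ (h - 1 - r) * Y (c - h) ^ r *
          (a t * (X (c - h) ^ (k - t) * Y (c - h) ^ t)))"
      proof (rule sum.cong)
        fix t assume "t \<in> {..k}"
        then have "?n - 1 - (t + r) = (h - 1 - r) + (k - t)"
          using 2 by auto
        then show "?g (t + r) = X (c - h) ^ (h - 1 - r) * Y (c - h) ^ r *
            (a t * (X (c - h) ^ (k - t) * Y (c - h) ^ t))"
          by (simp add: power_add algebra_simps)
      qed simp
      also have "\<dots> = 0"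
        using root[of "c - h"] 2 c by (simp add: sum_distrib_left[symmetric])
      finally show ?thesis
        using 2 r c by auto
    next
      case 3
      have "(?D * W) $$ (r, c) = (\<Sum>s\<in>{0..<?n}. if s = e (r - h)
          then X (c - h) ^ (?n - 1 - s) * Y (c - h) ^ s else 0)"
        unfolding prod using 3 r c by (intro sum.cong) (auto simp: W_def)
      also have "\<dots> = X (c - h) ^ (?n - 1 - e (r - h)) * Y (c - h) ^ e (r - h)"
        using 3 r e[of "r - h"] by simp
      finally show ?thesis
        using 3 r c by auto
    qed
  qed (auto simp: W_def)
  then have "det (?D * W) = det ?T * det ?E"
    using det_four_block_mat_upper_right_zero[of ?T h "0\<^sub>m h k" k ?C ?E] by simp
  also have "det ?T = a 0 ^ h"
    by (subst det_upper_triangular_mat) auto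
  finally show ?thesis
    using det_mult[OF band_mat_carrier W, of a "\<lambda>m c. if c = e m then 1 else 0"] detW by simp
qed

section \<open>Linearity in a row and Cramer's rule\<close>

lemma det_row_combination:
  fixes P Q R :: "'r::comm_ring_1 mat"
  assumes "P \<in> carrier_mat n n" "Q \<in> carrier_mat n n" "R \<in> carrier_mat n n" and i: "i < n"
    and "\<And>r c. r < n \<Longrightarrow> c < n \<Longrightarrow> r \<noteq> i \<Longrightarrow> Q $$ (r, c) = P $$ (r, c) \<and> R $$ (r, c) = P $$ (r, c)"
    and row: "\<And>c. c < n \<Longrightarrow> P $$ (i, c) = x * Q $$ (i, c) + y * R $$ (i, c)"
  shows "det P = x * det Q + y * det R"
proof -
  have del: "mat_delete P i c = mat_delete Q i c" "mat_delete P i c = mat_delete R i c" if "c < n" for c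
    using assms that by (auto simp: mat_delete_def intro!: eq_matI)
  have "det P = (\<Sum>c<n. P $$ (i, c) * cofactor P i c)"
    by (rule laplace_expansion_row) fact+
  also have "\<dots> = (\<Sum>c<n. x * (Q $$ (i, c) * cofactor Q i c) + y * (R $$ (i, c) * cofactor R i c))"
    using row del by (intro sum.cong) (auto simp: cofactor_def algebra_simps)
  also have "\<dots> = x * det Q + y * det R"
    using laplace_expansion_row[of Q n i] laplace_expansion_row[of R n i] assms(2,3) i
    by (simp add: sum.distrib sum_distrib_left)
  finally show ?thesis .
qed

text \<open>The identity \<open>adj_mat B * B = det B\<close> read for a row vector
  \<open>p\<close>: without any division, \<open>det B * p\<close> is a combination of the rows of
  \<open>B\<close>, with explicit coefficients from the cofactors.\<close>

lemma cramer_row: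
  fixes B :: "'r::comm_ring_1 mat"
  assumes B: "B \<in> carrier_mat n n" and c: "c < n"
  shows "det B * p c = (\<Sum>r\<in>{0..<n}. (\<Sum>c'\<in>{0..<n}. p c' * cofactor B r c') * B $$ (r, c))"
proof -
  have adj: "(\<Sum>r\<in>{0..<n}. cofactor B r c' * B $$ (r, c)) = (if c' = c then det B else 0)"
    if "c' < n" for c'
  proof -
    have "(adj_mat B * B) $$ (c', c) = (\<Sum>r\<in>{0..<n}. cofactor B r c' * B $$ (r, c))"
      using B c that by (simp add: adj_mat_def scalar_prod_def)
    then show ?thesis
      using adj_mat(3)[OF B] c that by auto
  qed
  have "(\<Sum>r\<in>{0..<n}. (\<Sum>c'\<in>{0..<n}. p c' * cofactor B r c') * B $$ (r, c))
      = (\<Sum>c'\<in>{0..<n}. p c' * (\<Sum>r\<in>{0..<n}. cofactor B r c' * B $$ (r, c)))"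
    unfolding sum_distrib_right sum_distrib_left by (subst sum.swap) (simp add: mult.assoc)
  also have "\<dots> = (\<Sum>c'\<in>{0..<n}. if c' = c then p c' * det B else 0)"
    by (intro sum.cong) (auto simp: adj)
  finally show ?thesis
    using c by (simp add: mult.commute)
qed

section \<open>Ideals of subrings\<close>

locale ideal_subset = ring_subset A for A :: "'r::comm_ring_1 set" +
  fixes J :: "'r set"
  assumes ideal_subset: "J \<subseteq> A"
    and ideal_zero [simp, intro]: "0 \<in> J"
    and ideal_add [simp, intro]: "x \<in> J \<Longrightarrow> y \<in> J \<Longrightarrow> x + y \<in> J"
    and ideal_mult [simp, intro]: "x \<in> A \<Longrightarrow> y \<in> J \<Longrightarrow> x * y \<in> J"
begin

lemma ideal_sum: "(\<And>i. i \<in> S \<Longrightarrow> f i \<in> J) \<Longrightarrow> sum f S \<in> J"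
  by (induction S rule: infinite_finite_induct) auto

lemma ideal_diff: "x \<in> J \<Longrightarrow> y \<in> J \<Longrightarrow> x - y \<in> J"
  using ideal_add[of x "- 1 * y"] ideal_mult[of "- 1" y] by simp

lemma of_nat_closed: "of_nat n \<in> A"
  by (induction n) auto

text \<open>Every permutation other than the identity sends some \<open>i\<close> to a smaller
  index, so its Leibniz term has a factor below the diagonal.\<close>

lemma det_triangular_mod_ideal:
  assumes A: "\<And>i j. i < n \<Longrightarrow> j < n \<Longrightarrow> g i j \<in> A"
    and J: "\<And>i j. j < i \<Longrightarrow> i < n \<Longrightarrow> g i j \<in> J"
  shows "det (mat n n (\<lambda>(i, j). g i j)) - (\<Prod>i\<in>{0..<n}. g i i) \<in> J"
proof -
  let ?P = "{\<pi>. \<pi> permutes {0..<n}}"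
  let ?t = "\<lambda>\<pi>. signof \<pi> * (\<Prod>i\<in>{0..<n}. g i (\<pi> i))"
  have fin: "finite ?P" by (rule finite_permutations) simp
  have "det (mat n n (\<lambda>(i, j). g i j)) = ?t id + (\<Sum>\<pi>\<in>?P - {id}. ?t \<pi>)"
    unfolding det_mat_permute_sum using fin by (intro sum.remove) (auto simp: permutes_id)
  moreover have "(\<Sum>\<pi>\<in>?P - {id}. ?t \<pi>) \<in> J"
  proof (rule ideal_sum)
    fix \<pi> assume \<pi>: "\<pi> \<in> ?P - {id}"
    then have "\<not> (\<forall>i\<in>{0..<n}. i \<le> \<pi> i)"
      using permutes_natset_ge[of \<pi> "{0..<n}"] by auto
    then obtain i where i: "i < n" "\<pi> i < i"
      by (auto simp: not_le)
    have "(\<Prod>i\<in>{0..<n}. g i (\<pi> i)) = (\<Prod>j\<in>{0..<n} - {i}. g j (\<pi> j)) * g i (\<pi> i)"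
      using i by (subst prod.remove[of _ i]) (auto simp: mult.commute)
    moreover have "(\<Prod>j\<in>{0..<n} - {i}. g j (\<pi> j)) \<in> A"
      using \<pi> by (intro prod_closed A) (auto simp: permutes_lessI)
    ultimately show "?t \<pi> \<in> J"
      using J i by auto
  qed
  ultimately show ?thesis by simp
qed

section \<open>The radical of an ideal of a subring\<close>

definition radical :: "'r set" where
  "radical = {x \<in> A. \<exists>m. x ^ m \<in> J}"

lemma ideal_power_ge: "x \<in> A \<Longrightarrow> x ^ m \<in> J \<Longrightarrow> m \<le> n \<Longrightarrow> x ^ n \<in> J"
  using ideal_mult[of "x ^ (n - m)" "x ^ m"] by (simp add: power_add[symmetric])

text \<open>For sums: each term of the expansion of \<open>(x + y) ^ (m + n)\<close> contains
  \<open>x\<close> to a power at least \<open>m\<close> or \<open>y\<close> to a power at least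
  \<open>n\<close>.\<close>

lemma ideal_subset_radical: "ideal_subset A radical"
proof
  fix x y assume "x \<in> radical" "y \<in> radical"
  then obtain m n where mn: "x ^ m \<in> J" "y ^ n \<in> J" and A: "x \<in> A" "y \<in> A"
    by (auto simp: radical_def)
  have "(x + y) ^ (m + n) = (\<Sum>j\<le>m + n. of_nat (m + n choose j) * x ^ j * y ^ (m + n - j))"
    by (rule binomial_ring)
  also have "\<dots> \<in> J"
  proof (rule ideal_sum)
    fix j
    show "of_nat (m + n choose j) * x ^ j * y ^ (m + n - j) \<in> J"
    proof (cases "j \<ge> m")
      case True
      then have "(of_nat (m + n choose j) * y ^ (m + n - j)) * x ^ j \<in> J"
        using ideal_power_ge[OF A(1) mn(1)] A of_nat_closed by (intro ideal_mult mult_closed) auto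
      then show ?thesis by (simp add: algebra_simps)
    next
      case False
      then show ?thesis
        using ideal_power_ge[OF A(2) mn(2)] A of_nat_closed by (intro ideal_mult mult_closed) auto
    qed
  qed
  finally show "x + y \<in> radical"
    using A by (auto simp: radical_def)
next
  show "0 \<in> radical"
    by (auto simp: radical_def intro!: exI[of _ 1])
  fix x y assume "x \<in> A" "y \<in> radical"
  then show "x * y \<in> radical"
    by (auto simp: radical_def power_mult_distrib)
qed (auto simp: radical_def)

lemma radical_power: "x \<in> A \<Longrightarrow> x ^ m \<in> radical \<Longrightarrow> x \<in> radical"
  unfolding radical_def by (auto simp: power_mult[symmetric])

lemma ideal_in_radical: "J \<subseteq> radical"
  using ideal_subset unfolding radical_def by (auto intro!: exI[of _ 1])

lemma one_in_radical: "1 \<in> radical \<Longrightarrow> 1 \<in> J"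
  by (auto simp: radical_def)

end

section \<open>The exterior power of the quotient on a chart\<close>

text \<open>One standard chart, abstractly: \<open>a j\<close> stands for the quotient of the
  coordinates \<open>j\<close> and \<open>i\<close>, hence \<open>a i = 1\<close>. The ring is a
  domain for the sake of cancellation and of the kernel criterion for vanishing
  determinants.\<close>

locale monic_form = ring_subset A for A :: "'r::idom set" +
  fixes h k i :: nat and a :: "nat \<Rightarrow> 'r"
  assumes a_closed: "j \<le> k \<Longrightarrow> a j \<in> A" and h: "h \<ge> 1" and i: "i \<le> k" and a_i: "a i = 1"
begin

definition F :: "'r mpoly" where
  "F = (\<Sum>j\<le>k. const (a j) * monomial (mon (k - j) j))"

text \<open>Coordinates of forms of degree \<open>h + k - 1\<close>, numbered by the exponent of
  \<open>y\<close> like the columns of \<open>band_mat\<close>.\<close>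

definition cf :: "'r mpoly \<Rightarrow> nat \<Rightarrow> 'r" where
  "cf p c = Poly_Mapping.lookup p (mon (h + k - 1 - c) c)"

abbreviation M :: "'r mpoly set" where
  "M \<equiv> forms A {0, 1} (h + k - 1)"

definition I :: "'r mpoly set" where
  "I = {F * g | g. g \<in> polys A {0, 1}} \<inter> M"

definition \<phi>\<^sub>0 :: "'r mpoly list \<Rightarrow> 'r" where
  "\<phi>\<^sub>0 ps = det (band_mat h k a (\<lambda>m c. cf (ps ! m) c))"

definition dual :: "('r mpoly list \<Rightarrow> 'r) \<Rightarrow> bool" where
  "dual \<phi> \<longleftrightarrow> alternating_form A M k \<phi> \<and>
     (\<forall>ps. length ps = k \<and> set ps \<subseteq> M \<and> set ps \<inter> I \<noteq> {} \<longrightarrow> \<phi> ps = 0)"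

lemma alternatingI: "alternating_form A M l \<phi> \<Longrightarrow> alternating A M l \<phi>"
  by unfold_locales (auto intro: forms_add forms_scale)

lemma cf_closed: "p \<in> M \<Longrightarrow> cf p c \<in> A"
  unfolding cf_def by (rule forms_coeff)

lemma cf_hom [simp]: "cf (p + q) c = cf p c + cf q c" "cf (const x * p) c = x * cf p c"
  by (simp_all add: cf_def lookup_add)

lemma cf_sum: "cf (\<Sum>i\<in>S. f i) c = (\<Sum>i\<in>S. cf (f i) c)"
  by (simp add: cf_def lookup_sum)

lemma F_form: "F \<in> forms A {0, 1} k"
  unfolding F_def using a_closed by (intro forms_sum forms_scale monomial_mon_in_forms) auto

text \<open>The cofactor \<open>g\<close> need not be homogeneous, but only its part of degree
  \<open>h - 1\<close> reaches these coordinates. So a multiple of \<open>F\<close> has coordinates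
  in the span of the shift rows.\<close>

lemma cf_F_mult:
  assumes c: "c < h + k"
  shows "cf (F * g) c = (\<Sum>r\<in>{0..<h}. Poly_Mapping.lookup g (mon (h - 1 - r) r) *
    (if r \<le> c \<and> c \<le> r + k then a (c - r) else 0))"
proof -
  let ?g = "\<lambda>r. Poly_Mapping.lookup g (mon (h - 1 - r) r)"
  have coeff: "Poly_Mapping.lookup (monomial (mon (k - j) j) * g) (mon (h + k - 1 - c) c)
      = (if j \<le> c \<and> c < h + j then ?g (c - j) else 0)" if j: "j \<le> k" for j
  proof (cases "j \<le> c \<and> c < h + j")
    case True
    then have "mon (h + k - 1 - c) c = mon (k - j) j + mon (h - 1 - (c - j)) (c - j)"
      using j c by (auto simp: mon_add)
    then show ?thesis
      using True by (simp add: lookup_monomial_mult)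
  next
    case False
    have "mon (h + k - 1 - c) c \<noteq> mon (k - j) j + n" for n
    proof
      assume eq: "mon (h + k - 1 - c) c = mon (k - j) j + n"
      from arg_cong[OF eq, of "\<lambda>m. Poly_Mapping.lookup m 0"]
        arg_cong[OF eq, of "\<lambda>m. Poly_Mapping.lookup m (Suc 0)"]
      have "h + k - 1 - c \<ge> k - j" "c \<ge> j" by (simp_all add: lookup_add)
      then show False using False j c h by auto
    qed
    then show ?thesis
      using False by (subst lookup_monomial_mult_eq_0) auto
  qed
  have "cf (F * g) c = (\<Sum>j\<le>k. a j * (if j \<le> c \<and> c < h + j then ?g (c - j) else 0))"
    unfolding cf_def F_def sum_distrib_right lookup_sum
    by (intro sum.cong refl) (simp only: mult.assoc lookup_const_mult coeff atMost_iff)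
  also have "\<dots> = (\<Sum>j\<in>{j. j \<le> k \<and> j \<le> c \<and> c < h + j}. ?g (c - j) * a j)"
    by (rule sum.mono_neutral_cong_right) (auto simp: mult.commute)
  also have "\<dots> = (\<Sum>r\<in>{r. r < h \<and> r \<le> c \<and> c \<le> r + k}. ?g r * a (c - r))"
    by (rule sum.reindex_bij_witness[where i = "\<lambda>r. c - r" and j = "\<lambda>j. c - j"]) auto
  also have "\<dots> = (\<Sum>r\<in>{0..<h}. ?g r * (if r \<le> c \<and> c \<le> r + k then a (c - r) else 0))"
    by (rule sum.mono_neutral_cong_left) auto
  finally show ?thesis .
qed

lemma F_monomial_in_I:
  assumes "\<And>r. r < h \<Longrightarrow> y r \<in> A"
  shows "F * (\<Sum>r\<in>{0..<h}. const (y r) * monomial (mon (h - 1 - r) r)) \<in> I"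
proof -
  let ?g = "\<Sum>r\<in>{0..<h}. const (y r) * monomial (mon (h - 1 - r) r)"
  have g: "?g \<in> forms A {0, 1} (h - 1)"
    using assms by (intro forms_sum forms_scale monomial_mon_in_forms) auto
  then have "F * ?g \<in> forms A {0, 1} (k + (h - 1))"
    by (intro forms_mult F_form)
  also have "k + (h - 1) = h + k - 1" using h by simp
  finally have "F * ?g \<in> M" .
  moreover have "?g \<in> polys A {0, 1}"
    using g by (simp add: forms_altdef)
  ultimately show ?thesis
    unfolding I_def by blast
qed

text \<open>The converse direction: each combination of the shift rows with coefficients
  \<open>y r\<close> is realised by an explicit multiple of \<open>F\<close>.\<close>

lemma cf_F_monomials:
  assumes c: "c < h + k"
  shows "cf (F * (\<Sum>r\<in>{0..<h}. const (y r) * monomial (mon (h - 1 - r) r))) c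
    = (\<Sum>r\<in>{0..<h}. y r * (if r \<le> c \<and> c \<le> r + k then a (c - r) else 0))"
  unfolding cf_F_mult[OF c]
proof (rule sum.cong)
  fix r assume r: "r \<in> {0..<h}"
  have "Poly_Mapping.lookup (\<Sum>r\<in>{0..<h}. const (y r) * monomial (mon (h - 1 - r) r)) (mon (h - 1 - r) r)
      = (\<Sum>r'\<in>{0..<h}. if r' = r then y r' else 0)"
    unfolding lookup_sum by (intro sum.cong) (auto simp: lookup_monomial)
  also have "\<dots> = y r"
    using r by simp
  finally show "Poly_Mapping.lookup (\<Sum>r\<in>{0..<h}. const (y r) * monomial (mon (h - 1 - r) r))
      (mon (h - 1 - r) r) * (if r \<le> c \<and> c \<le> r + k then a (c - r) else 0)
    = y r * (if r \<le> c \<and> c \<le> r + k then a (c - r) else 0)"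
    by simp
qed simp

section \<open>The determinant as an alternating form on the quotient\<close>

lemma band_mat_closed:
  assumes "length ps = k" "set ps \<subseteq> M" "r < h + k" "c < h + k"
  shows "band_mat h k a (\<lambda>m c. cf (ps ! m) c) $$ (r, c) \<in> A"
proof -
  have "ps ! m \<in> M" if "m < k" for m
    using assms(1,2) that by auto
  then show ?thesis
    using assms(3,4) a_closed by (auto intro!: cf_closed)
qed

lemma \<phi>\<^sub>0_closed: "length ps = k \<Longrightarrow> set ps \<subseteq> M \<Longrightarrow> \<phi>\<^sub>0 ps \<in> A"
  unfolding \<phi>\<^sub>0_def by (intro det_closed[OF band_mat_carrier] band_mat_closed)

text \<open>Covers additivity with \<open>x = y = 1\<close> and homogeneity with
  \<open>y = 0\<close> at once.\<close>

lemma \<phi>\<^sub>0_row: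
  assumes "length ps = k" "j < k" "\<And>c. c < h + k \<Longrightarrow> cf r c = x * cf p c + y * cf q c"
  shows "\<phi>\<^sub>0 (ps[j := r]) = x * \<phi>\<^sub>0 (ps[j := p]) + y * \<phi>\<^sub>0 (ps[j := q])"
  unfolding \<phi>\<^sub>0_def
  by (rule det_row_combination[where n = "h + k" and i = "h + j"])
    (use assms in \<open>auto simp: nth_list_update\<close>)

lemma \<phi>\<^sub>0_alternating: "alternating_form A M k \<phi>\<^sub>0"
  unfolding alternating_form_def
proof (intro allI impI conjI ballI; (elim conjE)?)
  fix ps :: "'r mpoly list" assume ps: "length ps = k" "set ps \<subseteq> M"
  show "\<phi>\<^sub>0 ps \<in> A"
    using ps by (rule \<phi>\<^sub>0_closed)
  show "\<phi>\<^sub>0 (ps[j := p + q]) = \<phi>\<^sub>0 (ps[j := p]) + \<phi>\<^sub>0 (ps[j := q])" if "j < k" for j p q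
    using \<phi>\<^sub>0_row[of ps j "p + q" 1 p 1 q] ps that by simp
  show "\<phi>\<^sub>0 (ps[j := const c * ps ! j]) = c * \<phi>\<^sub>0 ps" if "j < k" for j c
    using \<phi>\<^sub>0_row[of ps j "const c * ps ! j" c "ps ! j" 0 "ps ! j"] ps that by simp
  assume "\<not> distinct ps"
  then obtain m n where mn: "m < k" "n < k" "m \<noteq> n" "ps ! m = ps ! n"
    using ps by (auto simp: distinct_conv_nth)
  have "row (band_mat h k a (\<lambda>m c. cf (ps ! m) c)) (h + m)
      = row (band_mat h k a (\<lambda>m c. cf (ps ! m) c)) (h + n)"
    by (rule eq_vecI) (use mn in auto)
  then show "\<phi>\<^sub>0 ps = 0"
    unfolding \<phi>\<^sub>0_def using mn
    by (intro det_identical_rows[of _ "h + k" "h + m" "h + n"]) auto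
qed

text \<open>Row \<open>h + m\<close> is a combination of the shift rows with the coefficients of
  \<open>g\<close>. These coefficients, with \<open>- 1\<close> in position \<open>h + m\<close>,
  form a nonzero kernel vector of the transpose.\<close>

lemma \<phi>\<^sub>0_vanishes:
  assumes ps: "length ps = k" and m: "m < k" and p: "ps ! m = F * g"
  shows "\<phi>\<^sub>0 ps = 0"
proof -
  let ?B = "band_mat h k a (\<lambda>m c. cf (ps ! m) c)"
  let ?n = "h + k"
  let ?g = "\<lambda>r. Poly_Mapping.lookup g (mon (h - 1 - r) r)"
  define v where "v = vec ?n (\<lambda>r. if r < h then ?g r else if r = h + m then - 1 else 0)"
  have "transpose_mat ?B *\<^sub>v v = 0\<^sub>v ?n"
  proof (rule eq_vecI)
    fix c assume "c < dim_vec (0\<^sub>v ?n :: 'r vec)"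
    then have c: "c < ?n" by simp
    have "(transpose_mat ?B *\<^sub>v v) $ c = (\<Sum>r\<in>{0..<?n}. ?B $$ (r, c) * v $ r)"
      using c by (simp add: scalar_prod_def v_def)
    also have "{0..<?n} = {0..<h} \<union> {h..<?n}" by auto
    also have "(\<Sum>r\<in>\<dots>. ?B $$ (r, c) * v $ r)
        = (\<Sum>r\<in>{0..<h}. ?B $$ (r, c) * v $ r) + (\<Sum>r\<in>{h..<?n}. ?B $$ (r, c) * v $ r)"
      by (rule sum.union_disjoint) auto
    also have "(\<Sum>r\<in>{0..<h}. ?B $$ (r, c) * v $ r) = cf (F * g) c"
      unfolding cf_F_mult[OF c] using c by (intro sum.cong) (auto simp: v_def mult.commute)
    also have "(\<Sum>r\<in>{h..<?n}. ?B $$ (r, c) * v $ r) = (\<Sum>r\<in>{h..<?n}. if r = h + m then - cf (F * g) c else 0)"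
      using c p by (intro sum.cong) (auto simp: v_def)
    also have "\<dots> = - cf (F * g) c"
      using m by simp
    finally show "(transpose_mat ?B *\<^sub>v v) $ c = 0\<^sub>v ?n $ c"
      using c by simp
  qed simp
  moreover have "v \<in> carrier_vec ?n" by (simp add: v_def)
  moreover have "v \<noteq> 0\<^sub>v ?n"
  proof
    assume "v = 0\<^sub>v ?n"
    then have "v $ (h + m) = 0\<^sub>v ?n $ (h + m)" by simp
    then show False using m by (simp add: v_def)
  qed
  ultimately have "det (transpose_mat ?B) = 0"
    by (subst det_0_iff_vec_prod_zero[of _ ?n]) auto
  then show ?thesis
    unfolding \<phi>\<^sub>0_def by (simp add: det_transpose[OF band_mat_carrier])
qed

lemma dual_\<phi>\<^sub>0: "dual \<phi>\<^sub>0"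
  unfolding dual_def
proof (intro conjI allI impI \<phi>\<^sub>0_alternating; elim conjE)
  fix ps :: "'r mpoly list" assume ps: "length ps = k" "set ps \<inter> I \<noteq> {}"
  then obtain m g where "m < k" "ps ! m = F * g"
    unfolding I_def by (auto simp: in_set_conv_nth) metis
  then show "\<phi>\<^sub>0 ps = 0"
    using ps by (intro \<phi>\<^sub>0_vanishes)
qed

section \<open>Comparison of alternating forms on the quotient\<close>

lemma dual_scale: "c \<in> A \<Longrightarrow> dual \<phi> \<Longrightarrow> dual (\<lambda>ps. c * \<phi> ps)"
  unfolding dual_def alternating_form_def by (simp add: algebra_simps)

text \<open>Cramer's rule writes \<open>\<phi>\<^sub>0 qs\<close> times each \<open>ps ! j\<close>
  as a combination of the \<open>qs\<close> plus an element \<open>w j\<close> of \<open>I\<close>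
  coming from the shift rows. The factor \<open>x\<close> is the determinant of the coefficients on
  the \<open>qs\<close>; what matters is that it does not depend on \<open>\<phi>\<close>.\<close>

lemma dual_transform:
  assumes ps: "length ps = k" "set ps \<subseteq> M" and qs: "length qs = k" "set qs \<subseteq> M"
  shows "\<exists>x\<in>A. \<forall>\<phi>. dual \<phi> \<longrightarrow> \<phi>\<^sub>0 qs ^ k * \<phi> ps = x * \<phi> qs"
proof -
  let ?B = "band_mat h k a (\<lambda>m c. cf (qs ! m) c)"
  let ?n = "h + k"
  define y where "y j r = (\<Sum>c\<in>{0..<?n}. cf (ps ! j) c * cofactor ?B r c)" for j r
  have psM: "ps ! j \<in> M" if "j < k" for j using ps that by auto
  have qsM: "qs ! j \<in> M" if "j < k" for j using qs that by auto
  have y: "y j r \<in> A" if "j < k" "r < ?n" for j r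
    unfolding y_def using that psM
    by (intro sum_closed mult_closed cf_closed cofactor_closed[OF band_mat_carrier] band_mat_closed qs) auto
  define w where "w j = F * (\<Sum>r\<in>{0..<h}. const (y j r) * monomial (mon (h - 1 - r) r))" for j
  have wI: "w j \<in> I" if "j < k" for j
    unfolding w_def using that y by (intro F_monomial_in_I) auto
  have wM: "w j \<in> M" if "j < k" for j
    using wI[OF that] by (simp add: I_def)
  let ?b = "\<phi>\<^sub>0 qs"
  have b: "?b \<in> A" using qs by (rule \<phi>\<^sub>0_closed)
  have eq: "const ?b * ps ! j = (\<Sum>m\<in>{0..<k}. const (y j (h + m)) * qs ! m) + w j" if j: "j < k" for j
  proof (rule binary_form_eqI)
    show "const ?b * ps ! j \<in> M"
      using b psM j by (intro forms_scale) auto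
    show "(\<Sum>m\<in>{0..<k}. const (y j (h + m)) * qs ! m) + w j \<in> M"
      using y wM qsM j by (intro forms_add forms_sum forms_scale) auto
    fix c assume "c \<le> h + k - 1"
    then have c: "c < ?n" using h by simp
    have "?b * cf (ps ! j) c = (\<Sum>r\<in>{0..<?n}. y j r * ?B $$ (r, c))"
      unfolding y_def \<phi>\<^sub>0_def by (rule cramer_row[OF band_mat_carrier c])
    also have "\<dots> = (\<Sum>r\<in>{0..<h}. y j r * ?B $$ (r, c)) + (\<Sum>r\<in>{h..<?n}. y j r * ?B $$ (r, c))"
      by (rule sum.atLeastLessThan_concat[symmetric]) auto
    also have "(\<Sum>r\<in>{0..<h}. y j r * ?B $$ (r, c)) = cf (w j) c"
      unfolding w_def cf_F_monomials[OF c] using c by (intro sum.cong) auto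
    also have "(\<Sum>r\<in>{h..<?n}. y j r * ?B $$ (r, c)) = (\<Sum>m\<in>{0..<k}. y j (h + m) * cf (qs ! m) c)"
      using c by (intro sum.reindex_bij_witness[where i = "\<lambda>m. h + m" and j = "\<lambda>r. r - h"]) auto
    finally have "cf (const ?b * ps ! j) c = cf ((\<Sum>m\<in>{0..<k}. const (y j (h + m)) * qs ! m) + w j) c"
      by (simp add: cf_sum)
    then show "Poly_Mapping.lookup (const ?b * ps ! j) (mon (h + k - 1 - c) c)
        = Poly_Mapping.lookup ((\<Sum>m\<in>{0..<k}. const (y j (h + m)) * qs ! m) + w j) (mon (h + k - 1 - c) c)"
      unfolding cf_def .
  qed
  let ?x = "det (mat k k (\<lambda>(j, m). y j (h + m)))"
  have "\<forall>\<phi>. dual \<phi> \<longrightarrow> ?b ^ k * \<phi> ps = ?x * \<phi> qs"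
  proof (intro allI impI)
    fix \<phi> assume \<phi>: "dual \<phi>"
    then interpret alternating A M k \<phi>
      by (intro alternatingI) (simp add: dual_def)
    have "\<psi> (\<lambda>j. const ?b * ps ! j) = \<psi> (\<lambda>j. (\<Sum>m\<in>{0..<k}. const (y j (h + m)) * qs ! m) + w j)"
      by (rule \<psi>_cong) (simp add: eq)
    also have "\<dots> = ?x * \<psi> (\<lambda>j. qs ! j)"
    proof (rule \<psi>_det_mod)
      fix R m j assume R: "\<And>m. m < k \<Longrightarrow> R m \<in> M" "j < k" "m < k" "R j = w m"
      then have "set (map R [0..<k]) \<inter> I \<noteq> {}" "set (map R [0..<k]) \<subseteq> M"
        using wI[of m] by force+
      then show "\<psi> R = 0"
        using \<phi> unfolding dual_def \<psi>_def by simp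
    qed (use y qsM wM in auto)
    \<comment> \<open>Scaling all \<open>k\<close> slots by \<open>?b\<close> is the action of a
      scalar matrix, so \<open>\<psi>_det\<close> yields the factor \<open>?b ^ k\<close>.\<close>
    also have "\<psi> (\<lambda>j. const ?b * ps ! j)
        = \<psi> (\<lambda>j. \<Sum>m\<in>{0..<k}. const (if m = j then ?b else 0) * ps ! m)"
      by (rule \<psi>_cong) (simp add: if_distrib[of const] if_distrib[of "\<lambda>x. x * _"] cong: if_cong)
    also have "\<dots> = det (mat k k (\<lambda>(j, m). if m = j then ?b else 0)) * \<psi> (\<lambda>j. ps ! j)"
      by (rule \<psi>_det) (use b psM in auto)
    also have "det (mat k k (\<lambda>(j, m). if m = j then ?b else 0)) = ?b ^ k"
      by (subst det_upper_triangular_mat) auto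
    finally show "?b ^ k * \<phi> ps = ?x * \<phi> qs"
      using ps qs by (simp add: \<phi>_eq_\<psi>)
  qed
  moreover have "?x \<in> A"
    using y by (intro det_closed[of _ k]) auto
  ultimately show ?thesis by blast
qed

text \<open>The same \<open>x\<close> from \<open>dual_transform\<close> serves
  \<open>\<phi>\<close> and \<open>\<phi>\<^sub>0\<close>, and a nonzero power of
  \<open>\<phi>\<^sub>0 qs\<close> cancels. If \<open>\<phi>\<^sub>0 qs = 0\<close>, the roles of
  \<open>ps\<close> and \<open>qs\<close> are exchanged, unless both values vanish.\<close>

lemma dual_rank_one:
  assumes ps: "length ps = k" "set ps \<subseteq> M" and qs: "length qs = k" "set qs \<subseteq> M" and \<phi>: "dual \<phi>"
  shows "\<phi>\<^sub>0 qs * \<phi> ps = \<phi>\<^sub>0 ps * \<phi> qs"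
proof -
  have *: "\<phi>\<^sub>0 qs * \<phi> ps = \<phi>\<^sub>0 ps * \<phi> qs"
    if ps: "length ps = k" "set ps \<subseteq> M" and qs: "length qs = k" "set qs \<subseteq> M" and nz: "\<phi>\<^sub>0 qs \<noteq> 0"
    for ps qs
  proof -
    obtain x where x: "\<And>\<phi>. dual \<phi> \<Longrightarrow> \<phi>\<^sub>0 qs ^ k * \<phi> ps = x * \<phi> qs"
      using dual_transform[OF ps qs] by blast
    have "\<phi>\<^sub>0 qs ^ k * (\<phi>\<^sub>0 qs * \<phi> ps) = \<phi>\<^sub>0 qs * (\<phi>\<^sub>0 qs ^ k * \<phi> ps)"
      by simp
    also have "\<dots> = (x * \<phi>\<^sub>0 qs) * \<phi> qs"
      by (simp add: x[OF \<phi>])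
    also have "\<dots> = \<phi>\<^sub>0 qs ^ k * (\<phi>\<^sub>0 ps * \<phi> qs)"
      by (simp add: x[OF dual_\<phi>\<^sub>0, symmetric])
    finally show ?thesis
      using nz by simp
  qed
  show ?thesis
  proof (cases "\<phi>\<^sub>0 qs = 0")
    case True
    then show ?thesis
      using *[OF qs ps] by (cases "\<phi>\<^sub>0 ps = 0") auto
  next
    case False
    then show ?thesis by (rule *[OF ps qs])
  qed
qed

text \<open>The maximal minors of the band matrix generate the unit ideal: modulo \<open>a\<^sub>0, \<dots>, a\<^bsub>s-1\<^esub>\<close>
  the minor on the columns \<open>s, \<dots>, s + h - 1\<close> is triangular with diagonal \<open>a\<^sub>s\<close>. Hence
  inductively every \<open>a\<^sub>s\<close> with \<open>s \<le> i\<close> lies in the radical, and \<open>a\<^sub>i = 1\<close>.\<close>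

lemma one_in_ideal_of_minors:
  assumes "ideal_subset A J"
    and J: "\<And>qs. length qs = k \<Longrightarrow> set qs \<subseteq> M \<Longrightarrow> \<phi>\<^sub>0 qs \<in> J"
  shows "1 \<in> J"
proof -
  interpret J: ideal_subset A J by fact
  interpret N: ideal_subset A J.radical by (rule J.ideal_subset_radical)
  let ?n = "h + k"
  have "a s \<in> J.radical" if "s \<le> i" for s
    using that
  proof (induction s rule: less_induct)
    case (less s)
    have s: "s \<le> k" using less.prems i by simp
    \<comment> \<open>These are the \<open>k\<close> columns outside
      \<open>s, ..., s + h - 1\<close>. With the corresponding monomials as arguments,
      \<open>\<phi>\<^sub>0\<close> is up to sign the minor on the remaining columns.\<close>
    define col where "col m = (if m < s then m else m + h)" for m
    define qs :: "'r mpoly list"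
      where "qs = map (\<lambda>m. monomial (mon (h + k - 1 - col m) (col m))) [0..<k]"
    have col: "col m < ?n" if "m < k" for m
      using that s by (auto simp: col_def)
    have "monomial (mon (h + k - 1 - col m) (col m)) \<in> M" if "m < k" for m
      using col[OF that] by (intro monomial_mon_in_forms) simp
    then have qs: "length qs = k" "set qs \<subseteq> M"
      by (auto simp: qs_def)
    have cf: "cf (qs ! m) c = (if c = col m then 1 else 0)" if "m < k" for m c
      using that by (auto simp: qs_def cf_def lookup_monomial)
    let ?D = "band_mat h k a (\<lambda>m c. cf (qs ! m) c)"
    \<comment> \<open>The \<open>h\<close> shift rows are moved below the first \<open>s\<close>
      unit rows, at the cost of the sign \<open>(- 1) ^ (h * s)\<close>. The diagonal then consists
      of ones and of \<open>h\<close> copies of \<open>a s\<close>.\<close>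
    define g where "g r c = ?D $$ (if r < s then r + h else if r < h + s then r - s else r, c)" for r c
    have swap: "\<phi>\<^sub>0 qs = (- 1) ^ (h * s) * det (mat ?n ?n (\<lambda>(r, c). g r c))"
      unfolding \<phi>\<^sub>0_def g_def using s by (intro det_swap_initial_rows) auto
    have top: "g r c = (if c = r then 1 else 0)" if "r < s" "c < ?n" for r c
      using that s by (simp add: g_def cf col_def)
    have bottom: "g r c = (if c = r then 1 else 0)" if "h + s \<le> r" "r < ?n" "c < ?n" for r c
    proof -
      have "\<not> r - h < s"
        using that by linarith
      then have "col (r - h) = r"
        using that by (simp only: col_def if_False)
      moreover have "r - h < k"
        using that by linarith
      ultimately show ?thesis
        using that by (simp add: g_def cf)
    qed
    have mid: "g r c = (if r - s \<le> c \<and> c \<le> r - s + k then a (c - (r - s)) else 0)"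
      if "s \<le> r" "r < h + s" "c < ?n" for r c
    proof -
      have "r - s < h" using that by linarith
      then show ?thesis
        using that by (simp add: g_def)
    qed
    have gA: "g r c \<in> A" if "r < ?n" "c < ?n" for r c
    proof -
      consider "r < s" | "s \<le> r" "r < h + s" | "h + s \<le> r" by linarith
      then show ?thesis
      proof cases
        case 2
        have "a (c - (r - s)) \<in> A" if "c \<le> r - s + k"
          using that by (intro a_closed) linarith
        then show ?thesis
          unfolding mid[OF 2 that(2)] by (simp only: zero_closed split: if_split) blast
      qed (use that in \<open>simp_all add: top bottom\<close>)
    qed
    have "det (mat ?n ?n (\<lambda>(r, c). g r c)) - (\<Prod>r\<in>{0..<?n}. g r r) \<in> J.radical"
    proof (rule N.det_triangular_mod_ideal[OF gA])
      fix r c assume rc: "c < r" "r < ?n"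
      consider "r < s" | "s \<le> r" "r < h + s" | "h + s \<le> r" by linarith
      then show "g r c \<in> J.radical"
      proof cases
        case 2
        \<comment> \<open>Below the diagonal \<open>c < r\<close>, so the coefficient has index
          below \<open>s\<close> and the induction hypothesis applies.\<close>
        then have "a (c - (r - s)) \<in> J.radical" if "r - s \<le> c"
          using that rc less.prems by (intro less.IH) linarith+
        then show ?thesis
          using 2 rc by (simp add: mid)
      qed (use rc in \<open>simp_all add: top bottom\<close>)
    qed auto
    moreover have "(\<Prod>r\<in>{0..<?n}. g r r) = a s ^ h"
    proof -
      have "(\<Prod>r\<in>{0..<?n}. g r r) = (\<Prod>r\<in>{s..<h + s}. a s)"
        using s by (intro prod.mono_neutral_cong_right) (auto simp: top mid bottom not_less not_le)
      then show ?thesis by simp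
    qed
    moreover have "det (mat ?n ?n (\<lambda>(r, c). g r c)) \<in> J.radical"
    proof -
      have "(- 1) ^ (h * s) * \<phi>\<^sub>0 qs \<in> J.radical"
        using J[OF qs] J.ideal_in_radical by (intro N.ideal_mult) auto
      also have "(- 1) ^ (h * s) * \<phi>\<^sub>0 qs = det (mat ?n ?n (\<lambda>(r, c). g r c))"
        unfolding swap by (simp add: mult.assoc[symmetric] power_mult_distrib[symmetric])
      finally show ?thesis .
    qed
    ultimately have "a s ^ h \<in> J.radical"
      using N.ideal_diff[of "det (mat ?n ?n (\<lambda>(r, c). g r c))"
          "det (mat ?n ?n (\<lambda>(r, c). g r c)) - a s ^ h"] by simp
    then show ?case
      using a_closed[OF s] by (rule J.radical_power[rotated])
  qed
  from this[of i] show ?thesis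
    using a_i J.one_in_radical by simp
qed

text \<open>The multipliers that bring \<open>\<phi> ps\<close> into the ideal of
  \<open>\<phi>\<^sub>0 ps\<close> form an ideal \<open>J\<close>. By \<open>dual_rank_one\<close>
  it contains all values of \<open>\<phi>\<^sub>0\<close>, hence it contains 1.\<close>

lemma dual_multiple:
  assumes ps: "length ps = k" "set ps \<subseteq> M" and \<phi>: "dual \<phi>"
  shows "\<exists>c\<in>A. \<phi> ps = c * \<phi>\<^sub>0 ps"
proof -
  interpret \<phi>: alternating A M k \<phi>
    using \<phi> by (intro alternatingI) (simp add: dual_def)
  define J where "J = {b\<in>A. \<exists>c\<in>A. b * \<phi> ps = c * \<phi>\<^sub>0 ps}"
  have "ideal_subset A J"
  proof
    fix x y assume "x \<in> J" "y \<in> J"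
    then obtain c d where "x \<in> A" "y \<in> A" "c \<in> A" "d \<in> A"
      "x * \<phi> ps = c * \<phi>\<^sub>0 ps" "y * \<phi> ps = d * \<phi>\<^sub>0 ps"
      unfolding J_def by auto
    then show "x + y \<in> J"
      unfolding J_def by (auto intro!: bexI[of _ "c + d"] simp: algebra_simps)
  next
    fix x y assume "x \<in> A" "y \<in> J"
    then obtain c where "x \<in> A" "y \<in> A" "c \<in> A" "y * \<phi> ps = c * \<phi>\<^sub>0 ps"
      unfolding J_def by auto
    then show "x * y \<in> J"
      unfolding J_def by (auto intro!: bexI[of _ "x * c"] simp: mult.assoc)
  qed (auto simp: J_def intro!: bexI[of _ 0])
  moreover have "\<phi>\<^sub>0 qs \<in> J" if qs: "length qs = k" "set qs \<subseteq> M" for qs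
  proof -
    have "qs ! j \<in> M" if "j < k" for j
      using qs that by auto
    then have "\<phi> qs \<in> A"
      unfolding \<phi>.\<phi>_eq_\<psi>[OF qs(1)] by (rule \<phi>.\<psi>_closed)
    then show ?thesis
      unfolding J_def using dual_rank_one[OF ps qs \<phi>] \<phi>\<^sub>0_closed[OF qs]
      by (auto intro!: bexI[of _ "\<phi> qs"] simp: mult.commute)
  qed
  ultimately have "1 \<in> J"
    by (rule one_in_ideal_of_minors)
  then show ?thesis
    unfolding J_def by auto
qed

text \<open>\<open>dual_multiple\<close> shows that \<open>\<phi>\<^sub>0\<close> generates the
  values for each fixed ordering; another ordering changes the generator only by the sign of a
  permutation, a unit of \<open>A\<close>.\<close>

lemma dual_image:
  assumes us: "distinct us" "length us = k" "set (map monomial us) \<subseteq> M"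
  shows "{\<phi> (map monomial us') | \<phi> us'. dual \<phi> \<and> distinct us' \<and> set us' = set us}
    = {p * \<phi>\<^sub>0 (map monomial us) | p. p \<in> A}" (is "?L = ?R")
proof
  show "?R \<subseteq> ?L"
  proof
    fix z assume "z \<in> ?R"
    then obtain p where "p \<in> A" "z = p * \<phi>\<^sub>0 (map monomial us)" by auto
    then show "z \<in> ?L"
      using dual_scale[OF _ dual_\<phi>\<^sub>0, of p] us(1)
      by (intro CollectI exI[of _ "\<lambda>ps. p * \<phi>\<^sub>0 ps"] exI[of _ us]) simp
  qed
  show "?L \<subseteq> ?R"
  proof
    fix z assume "z \<in> ?L"
    then obtain \<phi> us' where z: "z = \<phi> (map monomial us')" and \<phi>: "dual \<phi>"
      and us': "distinct us'" "set us' = set us"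
      by auto
    let ?u = "\<lambda>us. map monomial us :: 'r mpoly list"
    interpret alternating A M k \<phi>\<^sub>0
      by (rule alternatingI) (rule \<phi>\<^sub>0_alternating)
    have len: "length us' = k"
      using us us' by (metis distinct_card)
    have "mset us' = mset us"
      using us(1) us' set_eq_iff_mset_eq_distinct by blast
    then obtain \<pi> where \<pi>: "\<pi> permutes {..<length us}" "permute_list \<pi> us = us'"
      by (rule mset_eq_permutation)
    then have \<pi>k: "\<pi> permutes {0..<k}" using us by (simp add: atLeast0LessThan)
    have "\<phi>\<^sub>0 (?u us') = \<psi> ((\<lambda>j. ?u us ! j) \<circ> \<pi>)"
      unfolding \<psi>_def using \<pi>(2) us(2) permutes_lessI[OF \<pi>k]
      by (intro arg_cong[where f = \<phi>\<^sub>0]) (auto simp: permute_list_def)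
    also have "\<dots> = signof \<pi> * \<phi>\<^sub>0 (?u us)"
      using us by (subst \<psi>_permute[OF \<pi>k]) (auto simp: \<phi>_eq_\<psi>)
    finally have sgn: "\<phi>\<^sub>0 (?u us') = signof \<pi> * \<phi>\<^sub>0 (?u us)" .
    have "length (?u us') = k" "set (?u us') \<subseteq> M"
      using len us(3) us' by simp_all
    then obtain c where c: "c \<in> A" "\<phi> (?u us') = c * \<phi>\<^sub>0 (?u us')"
      using dual_multiple[OF _ _ \<phi>] by blast
    then have "z = (c * signof \<pi>) * \<phi>\<^sub>0 (?u us)"
      by (simp add: z sgn)
    moreover have "c * signof \<pi> \<in> A"
      using c by auto
    ultimately show "z \<in> ?R" by blast
  qed
qed

end

section \<open>Monomials along the rim path\<close>

text \<open>With rows counted from zero, the downward step of row \<open>m\<close> comes after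
  \<open>c - rs ! m\<close> steps to the left and \<open>m\<close> steps down.\<close>

lemma rim_path_Downward:
  assumes "sorted_wrt (\<ge>) rs" "\<And>r. r \<in> set rs \<Longrightarrow> r \<le> c"
  shows "i < c + length rs \<and> rim_path c rs ! i = Downward
    \<longleftrightarrow> (\<exists>m<length rs. i = c - rs ! m + m)"
  using assms
proof (induction rs arbitrary: c i)
  case Nil
  then show ?case by (auto simp: nth_replicate)
next
  case (Cons r rs)
  have r: "r \<le> c" and le: "\<And>m. m < length rs \<Longrightarrow> rs ! m \<le> r"
    using Cons.prems by auto
  have ex: "(\<exists>m<length (r # rs). i = c - (r # rs) ! m + m) \<longleftrightarrow>
      i = c - r \<or> (\<exists>m<length rs. i = c - rs ! m + Suc m)"
    by (auto simp: less_Suc_eq_0_disj)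
  consider "i < c - r" | "i = c - r" | "i > c - r" by linarith
  then show ?case
  proof cases
    case 1
    have "i \<noteq> c - rs ! m + Suc m" if "m < length rs" for m
      using 1 le[OF that] by linarith
    then show ?thesis
      using 1 unfolding ex by (auto simp: nth_append)
  next
    case 2
    then show ?thesis
      using r unfolding ex by (auto simp: nth_append)
  next
    case 3
    \<comment> \<open>The position in the remaining path, which starts in column \<open>r\<close>
      after the first downward step.\<close>
    define j where "j = i - (c - r) - 1"
    have i: "i = c - r + Suc j" using 3 by (simp add: j_def)
    have "i < c + length (r # rs) \<and> rim_path c (r # rs) ! i = Downward
        \<longleftrightarrow> j < r + length rs \<and> rim_path r rs ! j = Downward"
      using r by (auto simp: i nth_append)
    also have "\<dots> \<longleftrightarrow> (\<exists>m<length rs. j = r - rs ! m + m)"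
      using Cons.prems by (intro Cons.IH) auto
    also have "\<dots> \<longleftrightarrow> (\<exists>m<length rs. i = c - rs ! m + Suc m)"
      using le r unfolding i by (intro ex_cong conj_cong refl) (auto dest!: le)
    also have "\<dots> \<longleftrightarrow> (\<exists>m<length (r # rs). i = c - (r # rs) ! m + m)"
      using 3 unfolding ex by auto
    finally show ?thesis .
  qed
qed

text \<open>The index of the downward step in row \<open>m\<close>, which is also the exponent of
  \<open>y\<close> in the monomial of that row.\<close>

definition y_exp :: "nat \<Rightarrow> nat list \<Rightarrow> nat \<Rightarrow> nat" where
  "y_exp h lam m = h - lam ! m + m"

lemma part_le_first:
  assumes "sorted_wrt (\<ge>) (lam :: nat list)" "m < length lam"
  shows "lam ! m \<le> lam ! 0"
  using assms by (cases "m = 0") (auto simp: sorted_wrt_iff_nth_less)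

lemma y_exp_less: "m < length lam \<Longrightarrow> y_exp h lam m < h + length lam"
  by (simp add: y_exp_def)

lemma y_exp_strict_mono:
  assumes "sorted_wrt (\<ge>) lam" "m < n" "n < length lam"
  shows "y_exp h lam m < y_exp h lam n"
proof -
  have "lam ! n \<le> lam ! m"
    using assms by (auto simp: sorted_wrt_iff_nth_less)
  then show ?thesis
    using assms by (simp add: y_exp_def)
qed

lemma inj_on_y_exp:
  assumes "sorted_wrt (\<ge>) lam"
  shows "inj_on (y_exp h lam) {0..<length lam}"
proof (rule inj_onI)
  fix m n assume "m \<in> {0..<length lam}" "n \<in> {0..<length lam}" "y_exp h lam m = y_exp h lam n"
  then show "m = n"
    using y_exp_strict_mono[OF assms, of m n h] y_exp_strict_mono[OF assms, of n m h]
    by (cases m n rule: linorder_cases) auto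
qed

definition mono_list :: "nat \<Rightarrow> nat list \<Rightarrow> (nat \<Rightarrow>\<^sub>0 nat) list" where
  "mono_list h lam =
    map (\<lambda>m. mon (h + length lam - 1 - y_exp h lam m) (y_exp h lam m)) [0..<length lam]"

lemma length_mono_list [simp]: "length (mono_list h lam) = length lam"
  by (simp add: mono_list_def)

lemma distinct_mono_list: "sorted_wrt (\<ge>) lam \<Longrightarrow> distinct (mono_list h lam)"
  using inj_on_y_exp[of lam h] by (auto simp: mono_list_def distinct_map inj_on_def)

lemma monomial_set_eq:
  assumes "sorted_wrt (\<ge>) lam" "lam ! 0 \<le> h"
  shows "monomial_set h lam = set (mono_list h lam)"
proof -
  have "r \<le> h" if "r \<in> set lam" for r
    using that assms part_le_first[OF assms(1)] by (force simp: in_set_conv_nth)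
  from rim_path_Downward[OF assms(1) this]
  have "monomial_set h lam = {mon (h + length lam - 1 - i) i |i. \<exists>m<length lam. i = y_exp h lam m}"
    unfolding monomial_set_def Let_def y_exp_def by simp
  then show ?thesis
    by (auto simp: mono_list_def)
qed

section \<open>Schur polynomials and the points of the projective line\<close>

interpretation UNIV_ring: ring_subset UNIV
  by (rule ring_subset_UNIV)

lemma point_form_in_forms: "(point_form k :: 'a::comm_ring_1 mpoly mpoly) \<in> forms UNIV {0, 1} k"
proof -
  have indet: "(indet v :: 'a mpoly mpoly) \<in> forms UNIV {0, 1} 1" if "v \<in> {0, 1}" for v
    unfolding indet_def
    by (rule UNIV_ring.forms_monomial) (use that in \<open>auto simp: total_degree_def\<close>)
  have "const (yv i) * indet 0 + const (- xv i) * indet 1 \<in> (forms UNIV {0, 1} 1 :: 'a mpoly mpoly set)" for i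
    by (intro UNIV_ring.forms_add UNIV_ring.forms_scale indet) auto
  then have "(point_form k :: 'a mpoly mpoly) \<in> forms UNIV {0, 1} (\<Sum>i\<in>{..<k}. 1)"
    unfolding point_form_def by (intro UNIV_ring.forms_prod) simp
  then show ?thesis by simp
qed

text \<open>Both sides are the value of \<open>point_form k\<close> at constants \<open>X\<close>
  and \<open>Y\<close>: once expanded by coefficients, once factor by factor. The value lies in the
  ring of constants, where \<open>const\<close> is injective.\<close>

lemma point_form_eval:
  "(\<Sum>t\<le>k. sym_coord k t * (X ^ (k - t) * Y ^ t)) = (\<Prod>i<k. yv i * X - xv i * Y)"
proof -
  define \<sigma> where "\<sigma> v = const (if v = 0 then X else Y)" for v :: nat
  have "const (\<Sum>t\<le>k. sym_coord k t * (X ^ (k - t) * Y ^ t)) = subst \<sigma> (point_form k)"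
    unfolding UNIV_ring.subst_binary_form[OF point_form_in_forms]
    by (simp add: sym_coord_def \<sigma>_def const_sum const_power)
  also have "\<dots> = const (\<Prod>i<k. yv i * X - xv i * Y)"
    unfolding point_form_def
    by (simp add: subst.hom_prod subst.hom_minus subst_mult \<sigma>_def const_prod)
  finally show ?thesis
    unfolding const_eq_iff .
qed

text \<open>Evaluation at \<open>X = 1\<close>, \<open>Y = 0\<close> isolates the coefficient of the
  pure power of \<open>x\<close>.\<close>

lemma sym_coord_0: "sym_coord k 0 = (\<Prod>i\<in>{0..<k}. yv i)"
proof -
  have "sym_coord k 0 = (\<Sum>t\<le>k. if t = 0 then sym_coord k t else 0)"
    by simp
  also have "\<dots> = (\<Sum>t\<le>k. sym_coord k t * (1 ^ (k - t) * 0 ^ t))"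
    by (intro sum.cong) (auto simp: power_0_left)
  also have "\<dots> = (\<Prod>i<k. yv i * 1 - xv i * 0)"
    by (rule point_form_eval)
  finally show ?thesis
    by (simp add: atLeast0LessThan)
qed

lemma elem_sym_0: "elem_sym k 0 = (\<Prod>i\<in>{0..<k}. yv i)"
proof -
  have "{A. A \<subseteq> {..<k} \<and> card A = 0} = {{}}"
    using finite_subset[of _ "{..<k}"] by auto
  then show ?thesis
    by (simp add: elem_sym_def atLeast0LessThan)
qed

text \<open>At the point number \<open>j\<close> the factor number \<open>j\<close> of the product
  vanishes.\<close>

lemma sym_coord_root:
  assumes "j < k"
  shows "(\<Sum>t\<le>k. sym_coord k t * (xv j ^ (k - t) * yv j ^ t)) = 0"
  unfolding point_form_eval using assms by (intro prod_zero) (auto simp: mult.commute)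

section \<open>Nonvanishing of the Vandermonde determinant\<close>

lemma yv_nonzero: "yv i \<noteq> (0 :: 'a::idom mpoly)"
  unfolding yv_def indet_def monomial_def by (metis lookup_single_eq lookup_zero zero_neq_one)

lemma monomial_zero [simp]: "monomial 0 = (1 :: 'r::comm_ring_1 mpoly)"
  by (simp add: monomial_def)

lemma indet_power: "(indet v :: 'r::comm_ring_1 mpoly) ^ n = monomial (Poly_Mapping.single v n)"
proof (induction n)
  case (Suc n)
  then show ?case
    by (simp add: indet_def monomial_mult single_add[symmetric])
qed simp

lemma monomial_prod: "(\<Prod>i\<in>S. monomial (f i) :: 'r::comm_ring_1 mpoly) = monomial (\<Sum>i\<in>S. f i)"
  by (induction S rule: infinite_finite_induct) (simp_all add: monomial_mult)

abbreviation vandermonde :: "nat \<Rightarrow> 'a::comm_ring_1 mpoly" where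
  "vandermonde k \<equiv> det (mat k k (\<lambda>(i, j). xv j ^ (k - 1 - i) * yv j ^ i))"

text \<open>The monomial of the diagonal arises from no other permutation, so its coefficient is
  1.\<close>

lemma vandermonde_nonzero: "vandermonde k \<noteq> (0 :: 'a::idom mpoly)"
proof
  assume 0: "vandermonde k = (0 :: 'a mpoly)"
  define f where "f \<pi> = (\<Sum>i\<in>{0..<k}. Poly_Mapping.single (2 * \<pi> i) (k - 1 - i)
    + Poly_Mapping.single (2 * \<pi> i + 1) i)" for \<pi> :: "nat \<Rightarrow> nat"
  have "vandermonde k = (\<Sum>\<pi> | \<pi> permutes {0..<k}. signof \<pi> * (monomial (f \<pi>) :: 'a mpoly))"
    unfolding det_mat_permute_sum f_def monomial_prod[symmetric] monomial_mult[symmetric]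
    by (simp add: xv_def yv_def indet_power)
  moreover have "Poly_Mapping.lookup (signof \<pi> * p) m = signof \<pi> * Poly_Mapping.lookup p m"
    for \<pi> :: "nat \<Rightarrow> nat" and p :: "'a mpoly" and m
    by (cases \<pi> rule: sign_cases) auto
  moreover have "f \<pi> = f id \<longleftrightarrow> \<pi> = id" if \<pi>: "\<pi> permutes {0..<k}" for \<pi>
  proof
    \<comment> \<open>The exponent of \<open>yv (\<pi> i)\<close> in the term of
      \<open>\<pi>\<close> is \<open>i\<close>, so the \<open>y\<close> variables alone recover the
      permutation.\<close>
    have odd: "Poly_Mapping.lookup (f \<pi>) (2 * \<pi> i + 1) = i" if "\<pi> permutes {0..<k}" "i < k" for \<pi> i
    proof -
      have "Poly_Mapping.lookup (f \<pi>) (2 * \<pi> i + 1) = (\<Sum>j\<in>{0..<k}. if j = i then j else 0)"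
        unfolding f_def lookup_sum
      proof (rule sum.cong)
        fix j assume "j \<in> {0..<k}"
        have "2 * \<pi> j \<noteq> 2 * \<pi> i + 1" by presburger
        moreover have "\<pi> j = \<pi> i \<longleftrightarrow> j = i"
          using that(1) by (simp add: permutes_inj inj_eq)
        ultimately show "Poly_Mapping.lookup (Poly_Mapping.single (2 * \<pi> j) (k - 1 - j)
            + Poly_Mapping.single (2 * \<pi> j + 1) j) (2 * \<pi> i + 1) = (if j = i then j else 0)"
          by (simp add: lookup_add lookup_single when_def)
      qed simp
      then show ?thesis using that(2) by simp
    qed
    assume eq: "f \<pi> = f id"
    have "\<pi> i = i" for i
    proof (cases "i < k")
      case True
      then show ?thesis
        using odd[OF \<pi> True] odd[OF permutes_id, of "\<pi> i"] eq permutes_lessI[OF \<pi> True] by simp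
    next
      case False
      then show ?thesis using \<pi> by (simp add: permutes_not_in)
    qed
    then show "\<pi> = id" by auto
  qed simp
  ultimately have "Poly_Mapping.lookup (vandermonde k :: 'a mpoly) (f id)
      = (\<Sum>\<pi> | \<pi> permutes {0..<k}. if \<pi> = id then 1 else 0)"
    unfolding lookup_sum by (auto simp: lookup_sum lookup_monomial intro!: sum.cong)
  also have "\<dots> = 1"
    by (simp add: finite_permutations permutes_id)
  finally show False
    using 0 by simp
qed

section \<open>Alternants and Schur polynomials from band determinants\<close>

lemma alternant_staircase: "alternant (map (\<lambda>i. k - 1 - i) [0..<k]) = vandermonde k"
  unfolding alternant_def by (intro arg_cong[where f = det] eq_matI) auto

text \<open>This is \<open>det_band_mat_roots\<close> at the generic points. There
  \<open>a 0\<close> is the product of all \<open>yv i\<close>, so its power \<open>h\<close> occurs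
  on both sides and cancels; the columns on the right still contribute the factors
  \<open>yv j ^ (h - lam ! 0)\<close>.\<close>

lemma det_band_mat_sym_coord:
  assumes lam: "sorted_wrt (\<ge>) lam" "length lam = k" "k \<ge> 1" "lam ! 0 \<le> h"
  shows "det (band_mat h k (sym_coord k) (\<lambda>m c. if c = y_exp h lam m then 1 else 0))
      * (vandermonde k :: 'a::idom mpoly)
    = elem_sym k 0 ^ (h - lam ! 0) * alternant (map (\<lambda>i. lam ! i + (k - 1 - i)) [0..<k])"
    (is "?D * _ = _ * alternant ?l")
proof -
  let ?y = "\<Prod>i\<in>{0..<k}. yv i :: 'a mpoly"
  have "?D * (?y ^ h * vandermonde k)
      = sym_coord k 0 ^ h * det (mat k k (\<lambda>(i, j). xv j ^ (h + k - 1 - y_exp h lam i) * yv j ^ y_exp h lam i))"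
    by (rule det_band_mat_roots) (use sym_coord_root y_exp_less lam(2) in blast)+
  also have "mat k k (\<lambda>(i, j). xv j ^ (h + k - 1 - y_exp h lam i) * yv j ^ y_exp h lam i)
      = (mat k k (\<lambda>(i, j). yv j ^ (h - lam ! 0) * (xv j ^ (?l ! i) * yv j ^ (?l ! 0 - ?l ! i))) :: 'a mpoly mat)"
  proof (rule eq_matI)
    fix i j assume "i < dim_row (mat k k (\<lambda>(i, j). yv j ^ (h - lam ! 0) *
        (xv j ^ (?l ! i) * yv j ^ (?l ! 0 - ?l ! i))) :: 'a mpoly mat)"
      and "j < dim_col (mat k k (\<lambda>(i, j). yv j ^ (h - lam ! 0) *
        (xv j ^ (?l ! i) * yv j ^ (?l ! 0 - ?l ! i))) :: 'a mpoly mat)"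
    then have ij: "i < k" "j < k" by auto
    have "lam ! i \<le> lam ! 0"
      using part_le_first[OF lam(1)] ij lam(2) by simp
    then have "h + k - 1 - y_exp h lam i = ?l ! i"
      and "y_exp h lam i = (h - lam ! 0) + (?l ! 0 - ?l ! i)"
      using ij lam(2-) by (auto simp: y_exp_def)
    then show "mat k k (\<lambda>(i, j). xv j ^ (h + k - 1 - y_exp h lam i) * yv j ^ y_exp h lam i) $$ (i, j)
      = (mat k k (\<lambda>(i, j). yv j ^ (h - lam ! 0) *
          (xv j ^ (?l ! i) * yv j ^ (?l ! 0 - ?l ! i))) :: 'a mpoly mat) $$ (i, j)"
      using ij by (simp only: index_mat prod.case power_add mult_ac)
  qed auto
  also have "det \<dots> = (\<Prod>j\<in>{0..<k}. yv j ^ (h - lam ! 0)) * alternant ?l"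
    unfolding det_scale_cols alternant_def by simp
  finally have "?y ^ h * (?D * vandermonde k) = ?y ^ h * (?y ^ (h - lam ! 0) * alternant ?l)"
    by (simp add: sym_coord_0 prod_power_distrib mult_ac)
  moreover have "?y ^ h \<noteq> 0"
    by (simp add: yv_nonzero)
  ultimately have "?D * vandermonde k = ?y ^ (h - lam ! 0) * alternant ?l"
    by (rule mult_left_cancel[THEN iffD1, rotated])
  then show ?thesis
    by (simp only: elem_sym_0)
qed

text \<open>The quotient exists because for \<open>h = lam ! 0\<close> the power of
  \<open>elem_sym k 0\<close> is trivial, so the band determinant itself is a quotient. It is unique
  because the Vandermonde determinant is nonzero in a domain.\<close>

lemma schur_mult_vandermonde:
  assumes lam: "sorted_wrt (\<ge>) lam" "length lam = k" "k \<ge> 1"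
  shows "schur lam * (vandermonde k :: 'a::idom mpoly) = alternant (map (\<lambda>i. lam ! i + (k - 1 - i)) [0..<k])"
  unfolding schur_def Let_def lam(2) alternant_staircase
proof (rule theI)
  show D: "det (band_mat (lam ! 0) k (sym_coord k) (\<lambda>m c. if c = y_exp (lam ! 0) lam m then 1 else 0))
      * (vandermonde k :: 'a mpoly) = alternant (map (\<lambda>i. lam ! i + (k - 1 - i)) [0..<k])"
    using det_band_mat_sym_coord[OF lam, of "lam ! 0"] by simp
  show "s = det (band_mat (lam ! 0) k (sym_coord k) (\<lambda>m c. if c = y_exp (lam ! 0) lam m then 1 else 0))"
    if "s * (vandermonde k :: 'a mpoly) = alternant (map (\<lambda>i. lam ! i + (k - 1 - i)) [0..<k])" for s
    using that[folded D] unfolding mult_right_cancel[OF vandermonde_nonzero] .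
qed

lemma map_mat_band_mat:
  "f 0 = 0 \<Longrightarrow> map_mat f (band_mat h k a v) = band_mat h k (\<lambda>j. f (a j)) (\<lambda>m c. f (v m c))"
  by (rule eq_matI) auto

text \<open>The form \<open>G\<close> in the homogeneous coordinates. Substituting
  \<open>chart_coord i\<close> gives the local generator of the dependence scheme, and substituting
  \<open>sym_coord k\<close> gives the symmetric polynomial.\<close>

definition dependence_form :: "nat \<Rightarrow> nat list \<Rightarrow> 'a::comm_ring_1 mpoly" where
  "dependence_form h lam =
    det (band_mat h (length lam) indet (\<lambda>m c. if c = y_exp h lam m then 1 else 0))"

lemma subst_dependence_form:
  "subst \<sigma> (dependence_form h lam)
    = det (band_mat h (length lam) \<sigma> (\<lambda>m c. if c = y_exp h lam m then 1 else 0))"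
  unfolding dependence_form_def subst.hom_det[symmetric]
  by (simp add: map_mat_band_mat if_distrib[of "subst \<sigma>"] cong: if_cong)

text \<open>In each Leibniz term the \<open>h\<close> shift rows contribute degree 1 each, and the
  remaining rows degree 0.\<close>

lemma dependence_form_in_forms: "dependence_form h lam \<in> forms UNIV {..length lam} h"
proof -
  let ?k = "length lam"
  have one: "(1 :: 'a mpoly) \<in> forms UNIV V 0" for V
    using UNIV_ring.forms_const[of 1] by simp
  have sgn: "(signof \<pi> :: 'a mpoly) \<in> forms UNIV V 0" for \<pi> :: "nat \<Rightarrow> nat" and V
    using UNIV_ring.forms_const[of "1 :: 'a"] UNIV_ring.forms_const[of "- 1 :: 'a"]
    by (cases \<pi> rule: sign_cases) auto
  have indet: "(indet j :: 'a mpoly) \<in> forms UNIV {..?k} (Suc 0)" if "j \<le> ?k" for j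
    unfolding indet_def
    by (rule UNIV_ring.forms_monomial) (use that in \<open>auto simp: total_degree_def\<close>)
  have entry: "(if r < h then if r \<le> c \<and> c \<le> r + ?k then indet (c - r) else 0
      else if c = y_exp h lam (r - h) then 1 else 0 :: 'a mpoly) \<in> forms UNIV {..?k} (if r < h then 1 else 0)" for r c
    using one by (auto intro: indet)
  have "(\<Sum>r\<in>{0..<h + ?k}. if r < h then 1 else 0) = (\<Sum>r\<in>{0..<h}. 1 :: nat)"
    by (rule sum.mono_neutral_cong_right) auto
  then have deg: "0 + (\<Sum>r\<in>{0..<h + ?k}. if r < h then 1 else 0) = h" by simp
  show ?thesis
    unfolding dependence_form_def band_mat_def det_mat_permute_sum
    \<comment> \<open>The degree \<open>h\<close> is rewritten as the sum of the row degrees, to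
      match the degree of a product.\<close>
    by (rule UNIV_ring.forms_sum, subst (3) deg[symmetric],
        rule UNIV_ring.forms_mult[OF sgn UNIV_ring.forms_prod], rule entry)
qed

lemma monic_form_chart:
  assumes "h \<ge> 1" "i \<le> k"
  shows "monic_form (chart_ring k i :: 'a::idom mpoly set) h k i (chart_coord i)"
proof -
  interpret R: ring_subset "chart_ring k i :: 'a mpoly set"
    unfolding chart_ring_def by (rule UNIV_ring.ring_subset_polys)
  show ?thesis
  proof
    fix j assume "j \<le> k"
    then show "chart_coord i j \<in> (chart_ring k i :: 'a mpoly set)"
      by (auto simp: chart_coord_def chart_ring_def polys_def monomial_def indet_def)
  qed (use assms in \<open>auto simp: chart_coord_def monomial_def\<close>)
qed

text \<open>Compared chart by chart: \<open>dual_image\<close> makes the ideal principal, and its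
  generator is \<open>G\<close> with the chart coordinates substituted.\<close>

lemma dependence_scheme_eq:
  fixes lam :: "nat list"
  assumes "h \<ge> 1" "length lam = k" "sorted_wrt (\<ge>) lam" "lam ! 0 \<le> h"
  shows "dependence_scheme k (h + k - 1) (monomial_set h lam)
    = zero_scheme k (dependence_form h lam :: 'a::idom mpoly)"
proof
  fix i
  show "dependence_scheme k (h + k - 1) (monomial_set h lam) i
    = zero_scheme k (dependence_form h lam :: 'a mpoly) i"
  proof (cases "i \<le> k")
    case True
    let ?A = "chart_ring k i :: 'a mpoly set"
    let ?us = "mono_list h lam"
    interpret monic_form ?A h k i "chart_coord i"
      using assms(1) True by (rule monic_form_chart)
    have F: "univ_form k i = F"
      by (simp add: univ_form_def F_def)
    have ext: "ext_quotient_dual k i (h + k - 1) k = {\<phi>. dual \<phi>}"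
      unfolding ext_quotient_dual_def dual_def univ_ideal_part_def I_def F ..
    have set: "monomial_set h lam = set ?us"
      using assms by (intro monomial_set_eq)
    have "monomial (mon (h + k - 1 - y_exp h lam m) (y_exp h lam m)) \<in> M" if "m < k" for m
      using y_exp_less[of m lam h] that assms(2) by (intro monomial_mon_in_forms) simp
    then have "set (map monomial ?us) \<subseteq> M"
      using assms(2) by (auto simp: mono_list_def)
    then have us: "distinct ?us" "length ?us = k" "set (map monomial ?us) \<subseteq> M"
      using assms by (simp_all add: distinct_mono_list)
    then have card: "card (set ?us) = k"
      by (simp add: distinct_card)
    have "cf (map monomial ?us ! m) c = (if c = y_exp h lam m then 1 else 0)" if "m < k" for m c
      using that assms(2) by (auto simp: cf_def mono_list_def lookup_monomial)
    then have "band_mat h k (chart_coord i) (\<lambda>m. cf (map monomial ?us ! m))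
        = band_mat h k (chart_coord i) (\<lambda>m c. if c = y_exp h lam m then 1 else 0 :: 'a mpoly)"
      by (intro eq_matI) auto
    then have "\<phi>\<^sub>0 (map monomial ?us) = subst (chart_coord i) (dependence_form h lam)"
      unfolding \<phi>\<^sub>0_def subst_dependence_form assms(2) by simp
    then show ?thesis
      using dual_image[OF us] True
      unfolding dependence_scheme_def zero_scheme_def set card ext mem_Collect_eq by simp
  qed (simp add: dependence_scheme_def zero_scheme_def)
qed

theorem theorem3p7:
  fixes h k :: nat and lam :: "nat list"
  assumes "h \<ge> 1" and "k \<ge> 1"
    and "length lam = k" and "sorted_wrt (\<ge>) lam" and "lam ! 0 \<le> h"
  shows "is_vanishing_locus k h
    (elem_sym k 0 ^ (h - lam ! 0) * schur lam :: 'a::field mpoly)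
    (dependence_scheme k (h + k - 1) (monomial_set h lam))"
proof -
  let ?G = "dependence_form h lam :: 'a mpoly"
  \<comment> \<open>The Schur polynomial is known only through its product with the Vandermonde
    determinant, so the comparison is made after multiplication by it.\<close>
  have "subst (sym_coord k) ?G * vandermonde k
      = (elem_sym k 0 ^ (h - lam ! 0) * schur lam) * vandermonde k"
    using det_band_mat_sym_coord[of lam k h, where ?'a = 'a] assms
      schur_mult_vandermonde[of lam k, where ?'a = 'a]
    by (simp add: subst_dependence_form mult.assoc)
  then have "subst (sym_coord k) ?G = elem_sym k 0 ^ (h - lam ! 0) * schur lam"
    using vandermonde_nonzero[of k, where ?'a = 'a] by simp
  then have "corresponds k h ?G (elem_sym k 0 ^ (h - lam ! 0) * schur lam)"
    using dependence_form_in_forms[of h lam, where ?'a = 'a] assms(3) by (simp add: corresponds_def)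
  moreover have "dependence_scheme k (h + k - 1) (monomial_set h lam) = zero_scheme k ?G"
    using assms by (intro dependence_scheme_eq)
  ultimately show ?thesis
    unfolding is_vanishing_locus_def by blast
qed

end
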